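(* Let $\mathcal{H}$ be a reproducing kernel Hilbert space on a non-empty set $\Omega$, and let $A\in\mathcal{B}(\mathcal{H})$. Then for all $r\geq 1$ and all $\alpha\in[0,1]$, $$\mathbf{ber}^{2r}(A)\leq \mathbf{ber}\left(\alpha|A|^{2r}+(1-\alpha)|A^*|^{2r}\right).$$
   Context: Let $\mathbb{F}$ be $\mathbb{R}$ or $\mathbb{C}$ and $\Omega$ a non-empty set. A reproducing kernel Hilbert space $\mathcal{H}$ on $\Omega$ is a Hilbert space over $\mathbb{F}$ consisting of functions $\Omega\to\mathbb{F}$ such that every evaluation $f\mapsto f(\lambda)$, $\lambda\in\Omega$, is bounded. For $\lambda\in\Omega$, $k_\lambda\in\mathcal{H}$ is the unique vector with $f(\lambda)=\langle f,k_\lambda\rangle$ for all $f\in\mathcal{H}$; it is assumed that $k_\lambda\neq 0$ for every $\lambda$, and $\hat{k}_\lambda=k_\lambda/\|k_\lambda\|$. $\mathcal{B}(\mathcal{H})$ is the set of bounded linear operators on $\mathcal{H}$. The Berezin number of $A\in\mathcal{B}(\mathcal{H})$ is $\mathbf{ber}(A)=\sup_{\lambda\in\Omega}|\langle A\hat{k}_\lambda,\hat{k}_\lambda\rangle|$, and $\mathbf{ber}^{s}(A)$ means $(\mathbf{ber}(A))^{s}$. $|A|=(A^*A)^{1/2}$ and $|A^*|=(AA^* )^{1/2}$; real powers of positive operators are taken by the continuous functional calculus. *)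

theory Defs
  imports
    "HOL-Analysis.Analysis"
    "HOL-Computational_Algebra.Polynomial"
    "HOL-Library.Function_Algebras"
begin

section \<open>Reproducing kernel Hilbert spaces\<close>

text \<open>
  The scalar field, either \<open>\<real>\<close> or \<open>\<complex>\<close>, is a subset of the type \<^typ>\<open>complex\<close>. A function from
  the set \<open>points\<close> to the scalars is represented by a total function that is scalar-valued on
  \<open>points\<close> and zero elsewhere, so that the vector space operations are the pointwise ones
  (\<open>+\<close>, \<open>-\<close> and \<open>0\<close> on functions are those of \<^theory>\<open>HOL-Library.Function_Algebras\<close>).
\<close>

record 'o function_space =
  scalars :: "complex set"
  points :: "'o set"
  vectors :: "('o \<Rightarrow> complex) set"
  ip :: "('o \<Rightarrow> complex) \<Rightarrow> ('o \<Rightarrow> complex) \<Rightarrow> complex"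

definition fscale :: "complex \<Rightarrow> ('o \<Rightarrow> complex) \<Rightarrow> 'o \<Rightarrow> complex"  (infixr "\<cdot>" 75)
  where "c \<cdot> f = (\<lambda>x. c * f x)"

definition vnorm :: "'o function_space \<Rightarrow> ('o \<Rightarrow> complex) \<Rightarrow> real"
  where "vnorm \<H> f = sqrt (Re (ip \<H> f f))"

locale rkhs =
  fixes \<H> :: "'o function_space"
  assumes scalars: "scalars \<H> = \<real> \<or> scalars \<H> = UNIV"
    and points_nonempty: "points \<H> \<noteq> {}"
    and range: "\<And>f x. f \<in> vectors \<H> \<Longrightarrow> x \<in> points \<H> \<Longrightarrow> f x \<in> scalars \<H>"
    and vanish: "\<And>f x. f \<in> vectors \<H> \<Longrightarrow> x \<notin> points \<H> \<Longrightarrow> f x = 0"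
    and zero_closed: "0 \<in> vectors \<H>"
    and add_closed: "\<And>f g. f \<in> vectors \<H> \<Longrightarrow> g \<in> vectors \<H> \<Longrightarrow> f + g \<in> vectors \<H>"
    and scale_closed: "\<And>c f. c \<in> scalars \<H> \<Longrightarrow> f \<in> vectors \<H> \<Longrightarrow> c \<cdot> f \<in> vectors \<H>"
    and ip_scalar: "\<And>f g. f \<in> vectors \<H> \<Longrightarrow> g \<in> vectors \<H> \<Longrightarrow> ip \<H> f g \<in> scalars \<H>"
    and ip_add: "\<And>f g h. f \<in> vectors \<H> \<Longrightarrow> g \<in> vectors \<H> \<Longrightarrow> h \<in> vectors \<H> \<Longrightarrow>
        ip \<H> (f + g) h = ip \<H> f h + ip \<H> g h"
    and ip_scale: "\<And>c f g. c \<in> scalars \<H> \<Longrightarrow> f \<in> vectors \<H> \<Longrightarrow> g \<in> vectors \<H> \<Longrightarrow>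
        ip \<H> (c \<cdot> f) g = c * ip \<H> f g"
    and ip_commute: "\<And>f g. f \<in> vectors \<H> \<Longrightarrow> g \<in> vectors \<H> \<Longrightarrow> ip \<H> g f = cnj (ip \<H> f g)"
    and ip_pos: "\<And>f. f \<in> vectors \<H> \<Longrightarrow> f \<noteq> 0 \<Longrightarrow> 0 < Re (ip \<H> f f)"
    and complete: "\<And>s :: nat \<Rightarrow> 'o \<Rightarrow> complex.
        (\<And>n. s n \<in> vectors \<H>) \<Longrightarrow>
        (\<And>e. 0 < e \<Longrightarrow> \<exists>N. \<forall>m\<ge>N. \<forall>n\<ge>N. vnorm \<H> (s m - s n) < e) \<Longrightarrow>
        \<exists>f\<in>vectors \<H>. (\<lambda>n. vnorm \<H> (s n - f)) \<longlonglongrightarrow> 0"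
    and eval_bounded: "\<And>x. x \<in> points \<H> \<Longrightarrow> \<exists>C. \<forall>f\<in>vectors \<H>. cmod (f x) \<le> C * vnorm \<H> f"

definition rep_kernel :: "'o function_space \<Rightarrow> 'o \<Rightarrow> 'o \<Rightarrow> complex"
  where "rep_kernel \<H> x = (THE k. k \<in> vectors \<H> \<and> (\<forall>f\<in>vectors \<H>. f x = ip \<H> f k))"

definition normalized_kernel :: "'o function_space \<Rightarrow> 'o \<Rightarrow> 'o \<Rightarrow> complex"
  where "normalized_kernel \<H> x =
    complex_of_real (1 / vnorm \<H> (rep_kernel \<H> x)) \<cdot> rep_kernel \<H> x"


section \<open>Bounded operators\<close>

text \<open>
  Operators are extended by zero outside the space, so that each operator on the space has
  exactly one representative.
\<close>

definition bounded_ops :: "'o function_space \<Rightarrow> (('o \<Rightarrow> complex) \<Rightarrow> 'o \<Rightarrow> complex) set"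
  where "bounded_ops \<H> = {T.
    (\<forall>f. f \<notin> vectors \<H> \<longrightarrow> T f = 0) \<and>
    (\<forall>f\<in>vectors \<H>. T f \<in> vectors \<H>) \<and>
    (\<forall>f\<in>vectors \<H>. \<forall>g\<in>vectors \<H>. T (f + g) = T f + T g) \<and>
    (\<forall>c\<in>scalars \<H>. \<forall>f\<in>vectors \<H>. T (c \<cdot> f) = c \<cdot> T f) \<and>
    (\<exists>C. \<forall>f\<in>vectors \<H>. vnorm \<H> (T f) \<le> C * vnorm \<H> f)}"

definition op_norm ::
    "'o function_space \<Rightarrow> (('o \<Rightarrow> complex) \<Rightarrow> 'o \<Rightarrow> complex) \<Rightarrow> real"
  where "op_norm \<H> T = (SUP f\<in>{f \<in> vectors \<H>. vnorm \<H> f \<le> 1}. vnorm \<H> (T f))"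

definition adjoint_op ::
    "'o function_space \<Rightarrow> (('o \<Rightarrow> complex) \<Rightarrow> 'o \<Rightarrow> complex) \<Rightarrow> ('o \<Rightarrow> complex) \<Rightarrow> 'o \<Rightarrow> complex"
  where "adjoint_op \<H> A = (THE B. B \<in> bounded_ops \<H> \<and>
    (\<forall>f\<in>vectors \<H>. \<forall>g\<in>vectors \<H>. ip \<H> (A f) g = ip \<H> f (B g)))"

definition ber :: "'o function_space \<Rightarrow> (('o \<Rightarrow> complex) \<Rightarrow> 'o \<Rightarrow> complex) \<Rightarrow> real"
  where "ber \<H> A = (SUP x\<in>points \<H>.
    cmod (ip \<H> (A (normalized_kernel \<H> x)) (normalized_kernel \<H> x)))"


section \<open>Continuous functional calculus\<close>

definition spectrum_op ::
    "'o function_space \<Rightarrow> (('o \<Rightarrow> complex) \<Rightarrow> 'o \<Rightarrow> complex) \<Rightarrow> complex set"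
  where "spectrum_op \<H> T = {z \<in> scalars \<H>. \<not> (\<exists>S\<in>bounded_ops \<H>. \<forall>f\<in>vectors \<H>.
    S (T f - z \<cdot> f) = f \<and> T (S f) - z \<cdot> S f = f)}"

definition poly_op ::
    "'o function_space \<Rightarrow> real poly \<Rightarrow>
     (('o \<Rightarrow> complex) \<Rightarrow> 'o \<Rightarrow> complex) \<Rightarrow> ('o \<Rightarrow> complex) \<Rightarrow> 'o \<Rightarrow> complex"
  where "poly_op \<H> p T = (\<lambda>f. if f \<in> vectors \<H>
    then \<Sum>i\<le>degree p. complex_of_real (coeff p i) \<cdot> (T ^^ i) f else 0)"

text \<open>
  For self-adjoint \<open>T\<close> the spectrum is a compact subset of the real line and \<open>\<phi>(T)\<close>, for \<open>\<phi>\<close> real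
  and continuous on the spectrum, is the operator norm limit of \<open>p\<^sub>n(T)\<close> for any real polynomials
  \<open>p\<^sub>n\<close> converging to \<open>\<phi>\<close> uniformly on the spectrum. The value is unspecified
  for other \<open>T\<close> or \<open>\<phi>\<close>.
\<close>

definition cont_calc ::
    "'o function_space \<Rightarrow> (real \<Rightarrow> real) \<Rightarrow>
     (('o \<Rightarrow> complex) \<Rightarrow> 'o \<Rightarrow> complex) \<Rightarrow> ('o \<Rightarrow> complex) \<Rightarrow> 'o \<Rightarrow> complex"
  where "cont_calc \<H> \<phi> T = (THE B. B \<in> bounded_ops \<H> \<and>
    (\<forall>p :: nat \<Rightarrow> real poly.
      uniform_limit {t. complex_of_real t \<in> spectrum_op \<H> T} (\<lambda>n. poly (p n)) \<phi> sequentially \<longrightarrow>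
      (\<lambda>n. op_norm \<H> (poly_op \<H> (p n) T - B)) \<longlonglongrightarrow> 0))"

text \<open>
  Since \<open>0 powr s = 0\<close> for every \<open>s\<close>, this is the power of a positive operator only for \<open>s > 0\<close>.
\<close>

definition op_powr ::
    "'o function_space \<Rightarrow> (('o \<Rightarrow> complex) \<Rightarrow> 'o \<Rightarrow> complex) \<Rightarrow> real \<Rightarrow> ('o \<Rightarrow> complex) \<Rightarrow> 'o \<Rightarrow> complex"
  where "op_powr \<H> T s = cont_calc \<H> (\<lambda>t. t powr s) T"

definition abs_op ::
    "'o function_space \<Rightarrow> (('o \<Rightarrow> complex) \<Rightarrow> 'o \<Rightarrow> complex) \<Rightarrow> ('o \<Rightarrow> complex) \<Rightarrow> 'o \<Rightarrow> complex"
  where "abs_op \<H> A = op_powr \<H> (adjoint_op \<H> A \<circ> A) (1 / 2)"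

end

theory Submission
  imports Defs "HOL-Computational_Algebra.Fundamental_Theorem_Algebra"
begin

text \<open>
  Let \<open>k\<close> be a normalised kernel function. The Cauchy-Schwarz inequality alone bounds \<open>\<bar>\<langle>A k, k\<rangle>\<bar>\<close> by
  \<open>\<parallel>A k\<parallel>\<close> and, since \<open>\<langle>A k, k\<rangle> = \<langle>k, A\<^sup>* k\<rangle>\<close>, also by \<open>\<parallel>A\<^sup>* k\<parallel>\<close>. Here \<open>\<parallel>A k\<parallel> = \<parallel>\<bar>A\<bar> k\<parallel>\<close>, and
  for a positive operator \<open>T\<close> and a unit vector \<open>f\<close> McCarthy's inequality says
  \<open>\<parallel>T f\<parallel>\<^bsup>2r\<^esup> \<le> \<langle>T\<^bsup>2r\<^esup> f, f\<rangle>\<close>. So \<open>\<bar>\<langle>A k, k\<rangle>\<bar>\<^bsup>2r\<^esup>\<close> is at most \<open>\<langle>\<bar>A\<bar>\<^bsup>2r\<^esup> k, k\<rangle>\<close> and at most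
  \<open>\<langle>\<bar>A\<^sup>*\<bar>\<^bsup>2r\<^esup> k, k\<rangle>\<close>, hence at most their convex combination with weights \<open>\<alpha>\<close> and \<open>1 - \<alpha>\<close>
  (\<open>ber_pointwise_bound\<close>). The supremum over all points of the domain gives the claim.

  McCarthy's inequality (\<open>mccarthy_inequality\<close>) is Jensen's inequality for the functional calculus.
  The tangent to the convex function \<open>u\<^sup>r\<close> at \<open>c = \<parallel>T f\<parallel>\<^sup>2\<close>, taken at \<open>u = t\<^sup>2\<close>, is a polynomial \<open>p\<close>
  in \<open>t\<close> that lies below \<open>t\<^bsup>2r\<^esup>\<close>, and \<open>\<langle>p(T) f, f\<rangle> = c\<^sup>r\<close>.

  What remains is the continuous functional calculus of a self-adjoint operator \<open>T\<close> on a nonzero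
  space, over either field of scalars. All of it rests on one fact (\<open>poly_op_minimum_in_spectrum\<close>):
  for each real polynomial \<open>p\<close> some point \<open>t\<close> of the spectrum satisfies
  \<open>\<langle>p(T) f, f\<rangle> \<ge> p(t) \<parallel>f\<parallel>\<^sup>2\<close> for all \<open>f\<close>. Indeed, if \<open>m\<close> is the greatest lower bound of the quadratic
  form of \<open>p(T)\<close>, then \<open>p(T) - m\<close> is not bounded below. A nonzero real polynomial without zeros on
  the spectrum is, up to a constant, a product of linear factors \<open>x - t\<close> with \<open>t\<close> outside the
  spectrum and of quadratic factors \<open>(x - b)\<^sup>2 + c\<^sup>2\<close> with \<open>c \<noteq> 0\<close>, and each of these gives an operator
  that is bounded below; so \<open>p - m\<close> is zero or has a zero on the spectrum. The case \<open>p(x) = x\<close> shows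
  that the spectrum is not empty, which settles constant \<open>p\<close>.
  It follows that \<open>p \<mapsto> p(T)\<close> is monotone and bounded with respect to the values of \<open>p\<close> on the
  spectrum, and uniform limits of polynomials can be formed.

  Representing vectors, which are needed for the kernel functions, for adjoints and for the inverses
  that confine the spectrum of a bounded self-adjoint operator to an interval, all come from
  minimising a coercive quadratic functional (\<open>coercive_representation\<close>).
\<close>

section \<open>Real functions and polynomials\<close>

text \<open>
  This turns the non-negativity of a quadratic form along a line into a Cauchy-Schwarz inequality.
  The case \<open>c = 0\<close> matters too: with \<open>a = 0\<close> it expresses that a minimum is a critical point.
\<close>

lemma discriminant_bound:
  fixes a b c :: real
  assumes "\<And>t. 0 \<le> a + 2 * t * b + t\<^sup>2 * c" and "0 \<le> c"
  shows "b\<^sup>2 \<le> a * c"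
proof (cases "c = 0")
  case True
  have "b = 0"
  proof (rule ccontr)
    assume "b \<noteq> 0"
    then have "2 * (- (\<bar>a\<bar> + 1) / (2 * b)) * b = - (\<bar>a\<bar> + 1)" by simp
    then show False
      using assms(1)[of "- (\<bar>a\<bar> + 1) / (2 * b)"] True by simp
  qed
  then show ?thesis using True by simp
next
  case False
  with \<open>0 \<le> c\<close> have c: "0 < c" by simp
  then have "a + 2 * (- b / c) * b + (- b / c)\<^sup>2 * c = a - b\<^sup>2 / c"
    by (simp add: power2_eq_square)
  then have "b\<^sup>2 / c \<le> a" using assms(1)[of "- b / c"] by linarith
  then show ?thesis using c by (simp add: pos_divide_le_eq)
qed

lemma map_poly_of_real_add:
  "map_poly complex_of_real (p + q) = map_poly complex_of_real p + map_poly complex_of_real q"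
  by (rule poly_eqI) (simp add: coeff_map_poly)

lemma map_poly_of_real_mult:
  "map_poly complex_of_real (p * q) = map_poly complex_of_real p * map_poly complex_of_real q"
  by (induction p) (simp_all add: map_poly_pCons map_poly_of_real_add map_poly_smult)

lemma poly_map_poly_of_real:
  "poly (map_poly complex_of_real p) (complex_of_real x) = complex_of_real (poly p x)"
  by (induction p) (simp_all add: map_poly_pCons)

text \<open>
  A complex root \<open>z\<close> exists by the fundamental theorem of algebra. If it is not real, then \<open>p\<close> is
  divisible by the real quadratic polynomial with the roots \<open>z\<close> and \<open>cnj z\<close>.
\<close>

lemma real_poly_factor:
  fixes p :: "real poly"
  assumes "0 < degree p"
  shows "(\<exists>t q. p = [:- t, 1:] * q) \<or> (\<exists>b c q. c \<noteq> 0 \<and> p = [:b\<^sup>2 + c\<^sup>2, - 2 * b, 1:] * q)"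
proof -
  let ?p = "map_poly complex_of_real p"
  have "degree ?p = degree p" by (simp add: degree_map_poly)
  then have "\<not> constant (poly ?p)" using assms by (simp add: constant_degree)
  then obtain z where z: "poly ?p z = 0" using fundamental_theorem_of_algebra by blast
  show ?thesis
  proof (cases "Im z = 0")
    case True
    then have "z = complex_of_real (Re z)" by (simp add: complex_eq_iff)
    then have "poly p (Re z) = 0"
      using z poly_map_poly_of_real[of p "Re z"] by (metis of_real_eq_0_iff)
    then show ?thesis by (metis dvdE poly_eq_0_iff_dvd)
  next
    case False
    \<comment> \<open>The linear real remainder of \<open>p\<close> modulo \<open>d\<close> vanishes at the non-real \<open>z\<close>, so it is zero.\<close>
    define d where "d = [:(Re z)\<^sup>2 + (Im z)\<^sup>2, - 2 * Re z, 1:]"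
    have d0: "poly (map_poly complex_of_real d) z = 0"
      by (simp add: d_def map_poly_pCons complex_eq_iff power2_eq_square algebra_simps)
    have "degree (p mod d) < 2"
      using degree_mod_less'[of d p] by (cases "p mod d = 0") (auto simp: d_def)
    then obtain u v where uv: "p mod d = [:u, v:]"
      by (metis degree_eq_zeroE less_2_cases_iff degree1_coeffs One_nat_def pCons_0_0)
    have "map_poly complex_of_real p
        = map_poly complex_of_real (p div d) * map_poly complex_of_real d + map_poly complex_of_real [:u, v:]"
      by (metis div_mult_mod_eq map_poly_of_real_add map_poly_of_real_mult uv)
    then have "poly (map_poly complex_of_real [:u, v:]) z = 0"
      using z d0 by simp
    then have "u + v * Re z = 0 \<and> v * Im z = 0"
      by (simp add: map_poly_pCons complex_eq_iff mult.commute)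
    then have "v = 0" "u = 0" using False by auto
    then have "p mod d = 0" using uv by simp
    then have "p = [:(Re z)\<^sup>2 + (Im z)\<^sup>2, - 2 * Re z, 1:] * (p div d)"
      by (metis d_def mult.commute div_mult_mod_eq add_0_right)
    then show ?thesis using False by blast
  qed
qed

lemma fscale_simps:
  fixes f g :: "'o \<Rightarrow> complex"
  shows "a \<cdot> (f + g) = a \<cdot> f + a \<cdot> g" "a \<cdot> (f - g) = a \<cdot> f - a \<cdot> g"
    "(a + b) \<cdot> f = a \<cdot> f + b \<cdot> f" "(a - b) \<cdot> f = a \<cdot> f - b \<cdot> f"
    "a \<cdot> b \<cdot> f = (a * b) \<cdot> f" "0 \<cdot> f = 0" "a \<cdot> (0 :: 'o \<Rightarrow> complex) = 0" "1 \<cdot> f = f"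
  by (auto simp: fscale_def fun_eq_iff algebra_simps)

lemma fscale_sum: "(\<Sum>i\<in>I. a \<cdot> g i) = a \<cdot> (\<Sum>i\<in>I. g i)"
proof (induction I rule: infinite_finite_induct)
  case (infinite I)
  then show "(\<Sum>i\<in>I. a \<cdot> g i) = a \<cdot> (\<Sum>i\<in>I. g i)" by (simp add: fscale_simps)
next
  case empty
  show "(\<Sum>i\<in>{}. a \<cdot> g i) = a \<cdot> (\<Sum>i\<in>{}. g i)" by (simp add: fscale_simps)
next
  case (insert j I)
  then show "(\<Sum>i\<in>insert j I. a \<cdot> g i) = a \<cdot> (\<Sum>i\<in>insert j I. g i)"
    by (simp add: fscale_simps)
qed

text \<open>
  Convexity of \<open>u powr r\<close> on the positive half-line; at \<open>u = 0\<close> the tangent takes the value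
  \<open>(1 - r) * c powr r\<close>, which is not positive.
\<close>

lemma powr_above_tangent:
  fixes c r u :: real
  assumes "0 < c" "0 \<le> u" "1 \<le> r"
  shows "c powr r + r * c powr (r - 1) * (u - c) \<le> u powr r"
proof (cases "u = 0")
  case True
  have "c powr r = c powr (r - 1) * c" using assms powr_add[of c "r - 1" 1] by simp
  then have "c powr r + r * c powr (r - 1) * (u - c) = (1 - r) * c powr r"
    using True by (simp add: algebra_simps)
  also have "\<dots> \<le> 0" using assms by (simp add: mult_le_0_iff)
  finally show ?thesis using True by simp
next
  case False
  have "r * c powr (r - 1) * (u - c) \<le> u powr r - c powr r"
  proof (rule convex_on_imp_above_tangent[OF powr_convex[OF \<open>1 \<le> r\<close>]])
    show "((\<lambda>x. x powr r) has_real_derivative r * c powr (r - 1)) (at c within {0<..})"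
      using assms by (auto intro!: derivative_eq_intros)
  qed (use assms False in \<open>auto simp: interior_open\<close>)
  then show ?thesis by simp
qed

lemma polynomial_approximation:
  fixes \<phi> :: "real \<Rightarrow> real"
  assumes "continuous_on {a..b} \<phi>"
  obtains p where "uniform_limit {a..b} (\<lambda>n. poly (p n)) \<phi> sequentially"
proof -
  have "\<exists>p. \<forall>x\<in>{a..b}. \<bar>\<phi> x - poly p x\<bar> < 1 / (real n + 1)" for n
  proof -
    obtain g where g: "real_polynomial_function g"
      "\<And>x. x \<in> {a..b} \<Longrightarrow> \<bar>\<phi> x - g x\<bar> < 1 / (real n + 1)"
      using Stone_Weierstrass_real_polynomial_function[OF compact_Icc assms, of "1 / (real n + 1)"]
      by auto
    obtain c :: "nat \<Rightarrow> real" and N where "g = (\<lambda>x. \<Sum>i\<le>N. c i * x ^ i)"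
      using g(1) by (auto simp: real_polynomial_function_iff_sum)
    then have "g x = poly (\<Sum>i\<le>N. monom (c i) i) x" for x by (simp add: poly_sum poly_monom)
    then show ?thesis using g(2) by metis
  qed
  then obtain p where p: "\<And>n x. x \<in> {a..b} \<Longrightarrow> \<bar>\<phi> x - poly (p n) x\<bar> < 1 / (real n + 1)"
    by metis
  have "uniform_limit {a..b} (\<lambda>n. poly (p n)) \<phi> sequentially"
  proof (rule uniform_limitI)
    fix e :: real assume "0 < e"
    then obtain N where N: "1 / (real N + 1) < e"
      using nat_approx_posE[of e] by (auto simp: add.commute)
    have "dist (poly (p n) x) (\<phi> x) < e" if "N \<le> n" "x \<in> {a..b}" for n x
    proof -
      have "1 / (real n + 1) \<le> 1 / (real N + 1)" using that by (simp add: frac_le)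
      then show ?thesis using p[OF that(2), of n] N by (simp add: dist_real_def abs_minus_commute)
    qed
    then show "\<forall>\<^sub>F n in sequentially. \<forall>x\<in>{a..b}. dist (poly (p n) x) (\<phi> x) < e"
      unfolding eventually_sequentially by blast
  qed
  then show ?thesis by (rule that)
qed

section \<open>Geometry of the space\<close>

context rkhs
begin

abbreviation re_ip :: "('o \<Rightarrow> complex) \<Rightarrow> ('o \<Rightarrow> complex) \<Rightarrow> real"  ("\<langle>_, _\<rangle>")
  where "\<langle>f, g\<rangle> \<equiv> Re (ip \<H> f g)"

abbreviation norm_of :: "('o \<Rightarrow> complex) \<Rightarrow> real"  ("\<parallel>_\<parallel>")
  where "\<parallel>f\<parallel> \<equiv> vnorm \<H> f"

lemma real_scalar [simp]: "complex_of_real t \<in> scalars \<H>"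
  using scalars by (metis Reals_of_real UNIV_I)

lemma scale_real_closed [simp]: "f \<in> vectors \<H> \<Longrightarrow> complex_of_real t \<cdot> f \<in> vectors \<H>"
  by (rule scale_closed) simp_all

lemma minus_one_scalar [simp]: "- 1 \<in> scalars \<H>"
  using real_scalar[of "- 1"] by simp

text \<open>
  Closure under differences is derived from the other operations in this form.
\<close>

lemma diff_conv: "f - g = f + (- 1) \<cdot> (g :: 'o \<Rightarrow> complex)"
  by (auto simp: fscale_def fun_eq_iff)

lemma diff_closed [simp]:
  "f \<in> vectors \<H> \<Longrightarrow> g \<in> vectors \<H> \<Longrightarrow> f - g \<in> vectors \<H>"
  unfolding diff_conv by (intro add_closed scale_closed minus_one_scalar)

lemmas closed = zero_closed add_closed diff_closed scale_closed

lemma ip_add_right: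
  assumes "f \<in> vectors \<H>" "g \<in> vectors \<H>" "h \<in> vectors \<H>"
  shows "ip \<H> f (g + h) = ip \<H> f g + ip \<H> f h"
  using assms ip_commute[of "g + h" f] ip_commute[of g f] ip_commute[of h f]
  by (simp add: ip_add add_closed)

lemma ip_scale_right:
  assumes "c \<in> scalars \<H>" "f \<in> vectors \<H>" "g \<in> vectors \<H>"
  shows "ip \<H> f (c \<cdot> g) = cnj c * ip \<H> f g"
  using assms ip_commute[of "c \<cdot> g" f] ip_commute[of g f]
  by (simp add: ip_scale scale_closed)

lemma ip_diff_left:
  assumes "f \<in> vectors \<H>" "g \<in> vectors \<H>" "h \<in> vectors \<H>"
  shows "ip \<H> (f - g) h = ip \<H> f h - ip \<H> g h"
  using assms unfolding diff_conv by (simp add: ip_add ip_scale scale_closed)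

lemma ip_diff_right:
  assumes "f \<in> vectors \<H>" "g \<in> vectors \<H>" "h \<in> vectors \<H>"
  shows "ip \<H> f (g - h) = ip \<H> f g - ip \<H> f h"
  using assms unfolding diff_conv by (simp add: ip_add_right ip_scale_right scale_closed)

lemmas ip_simps = ip_add ip_add_right ip_diff_left ip_diff_right ip_scale ip_scale_right

lemma ip_zero_left [simp]: "f \<in> vectors \<H> \<Longrightarrow> ip \<H> 0 f = 0"
  using ip_add[of 0 0 f] zero_closed by simp

lemma ip_zero_right [simp]: "f \<in> vectors \<H> \<Longrightarrow> ip \<H> f 0 = 0"
  using ip_add_right[of f 0 0] zero_closed by simp

lemma re_ip_commute: "f \<in> vectors \<H> \<Longrightarrow> g \<in> vectors \<H> \<Longrightarrow> \<langle>f, g\<rangle> = \<langle>g, f\<rangle>"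
  using ip_commute[of f g] by simp

lemma re_ip_self_nonneg: "f \<in> vectors \<H> \<Longrightarrow> 0 \<le> \<langle>f, f\<rangle>"
  using ip_pos[of f] by (cases "f = 0") (auto simp: zero_closed)

lemma vnorm_sq: "f \<in> vectors \<H> \<Longrightarrow> \<parallel>f\<parallel>\<^sup>2 = \<langle>f, f\<rangle>"
  by (simp add: vnorm_def re_ip_self_nonneg)

lemma vnorm_nonneg [simp]: "f \<in> vectors \<H> \<Longrightarrow> 0 \<le> \<parallel>f\<parallel>"
  by (simp add: vnorm_def re_ip_self_nonneg)

lemma vnorm_eq_0: "f \<in> vectors \<H> \<Longrightarrow> \<parallel>f\<parallel> = 0 \<longleftrightarrow> f = 0"
  using ip_pos[of f] zero_closed by (cases "f = 0") (auto simp: vnorm_def)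

lemma vnorm_zero [simp]: "\<parallel>0\<parallel> = 0"
  using vnorm_eq_0 zero_closed by blast

lemma vnorm_pos: "f \<in> vectors \<H> \<Longrightarrow> f \<noteq> 0 \<Longrightarrow> 0 < \<parallel>f\<parallel>"
  using vnorm_eq_0[of f] vnorm_nonneg[of f] by linarith

lemma vnorm_scale:
  assumes "c \<in> scalars \<H>" "f \<in> vectors \<H>"
  shows "\<parallel>c \<cdot> f\<parallel> = cmod c * \<parallel>f\<parallel>"
proof -
  have "ip \<H> (c \<cdot> f) (c \<cdot> f) = complex_of_real ((cmod c)\<^sup>2) * ip \<H> f f"
    using assms by (simp add: ip_simps scale_closed mult.assoc[symmetric] complex_norm_square mult.commute[of "cnj c"]
        del: of_real_power)
  then show ?thesis
    by (simp add: vnorm_def real_sqrt_mult)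
qed

lemma vnorm_scale_real: "f \<in> vectors \<H> \<Longrightarrow> \<parallel>complex_of_real t \<cdot> f\<parallel> = \<bar>t\<bar> * \<parallel>f\<parallel>"
  using vnorm_scale[of "complex_of_real t" f] by simp

text \<open>
  The real part of the inner product is a real inner product on the space over either field, so
  the usual discriminant argument applies; the bound on the modulus below follows from this one.
\<close>

lemma re_ip_le:
  assumes "f \<in> vectors \<H>" "g \<in> vectors \<H>"
  shows "\<langle>f, g\<rangle> \<le> \<parallel>f\<parallel> * \<parallel>g\<parallel>"
proof -
  have "0 \<le> \<langle>f, f\<rangle> + 2 * t * \<langle>f, g\<rangle> + t\<^sup>2 * \<langle>g, g\<rangle>" for t
    using re_ip_self_nonneg[of "f + complex_of_real t \<cdot> g"] assms re_ip_commute[of f g]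
    by (simp add: ip_simps closed power2_eq_square algebra_simps)
  then have "\<langle>f, g\<rangle>\<^sup>2 \<le> (\<parallel>f\<parallel> * \<parallel>g\<parallel>)\<^sup>2"
    using discriminant_bound[of "\<langle>f, f\<rangle>" "\<langle>f, g\<rangle>" "\<langle>g, g\<rangle>"] assms re_ip_self_nonneg[of g]
    by (simp add: power_mult_distrib vnorm_sq)
  then show ?thesis
    using assms by (metis abs_le_square_iff abs_of_nonneg abs_le_D1 vnorm_nonneg mult_nonneg_nonneg)
qed

text \<open>
  Multiplying \<open>f\<close> by a unimodular scalar makes the inner product real and non-negative. Over \<open>\<real>\<close>
  this scalar is a sign, so it always belongs to the field.
\<close>

lemma cauchy_schwarz:
  assumes "f \<in> vectors \<H>" "g \<in> vectors \<H>"
  shows "cmod (ip \<H> f g) \<le> \<parallel>f\<parallel> * \<parallel>g\<parallel>"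
proof (cases "ip \<H> f g = 0")
  case True
  then show ?thesis using assms by simp
next
  case False
  let ?z = "ip \<H> f g"
  define c where "c = cnj ?z / complex_of_real (cmod ?z)"
  have c: "c \<in> scalars \<H>"
    using scalars ip_scalar[OF assms] by (auto simp: c_def elim!: Reals_cases)
  have "cmod ?z = \<langle>c \<cdot> f, g\<rangle>"
    using assms c False
    by (simp add: ip_scale c_def mult.commute[of "cnj ?z"] complex_norm_square[symmetric]
        power2_eq_square flip: of_real_mult of_real_divide)
  also have "\<dots> \<le> \<parallel>c \<cdot> f\<parallel> * \<parallel>g\<parallel>"
    using assms c by (simp add: re_ip_le closed)
  also have "\<dots> = \<parallel>f\<parallel> * \<parallel>g\<parallel>"
    using assms c False by (simp add: vnorm_scale) (simp add: c_def norm_divide)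
  finally show ?thesis .
qed

lemma vnorm_triangle:
  assumes "f \<in> vectors \<H>" "g \<in> vectors \<H>"
  shows "\<parallel>f + g\<parallel> \<le> \<parallel>f\<parallel> + \<parallel>g\<parallel>"
proof (rule power2_le_imp_le)
  have "\<parallel>f + g\<parallel>\<^sup>2 = \<parallel>f\<parallel>\<^sup>2 + 2 * \<langle>f, g\<rangle> + \<parallel>g\<parallel>\<^sup>2"
    using assms re_ip_commute[of f g] by (simp add: vnorm_sq ip_simps closed)
  then show "\<parallel>f + g\<parallel>\<^sup>2 \<le> (\<parallel>f\<parallel> + \<parallel>g\<parallel>)\<^sup>2"
    using re_ip_le[OF assms] by (simp add: power2_sum)
qed (use assms in simp)

lemma vnorm_minus_commute: "f \<in> vectors \<H> \<Longrightarrow> g \<in> vectors \<H> \<Longrightarrow> \<parallel>f - g\<parallel> = \<parallel>g - f\<parallel>"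
proof -
  assume "f \<in> vectors \<H>" "g \<in> vectors \<H>"
  moreover have "f - g = complex_of_real (- 1) \<cdot> (g - f)"
    by (simp add: fun_eq_iff fscale_def)
  ultimately show ?thesis by (metis vnorm_scale_real abs_1 abs_minus_cancel diff_closed mult_1)
qed

lemma vnorm_diff_triangle:
  assumes "f \<in> vectors \<H>" "g \<in> vectors \<H>" "h \<in> vectors \<H>"
  shows "\<parallel>f - h\<parallel> \<le> \<parallel>f - g\<parallel> + \<parallel>g - h\<parallel>"
  using vnorm_triangle[of "f - g" "g - h"] assms by simp

lemma abs_vnorm_diff:
  assumes "f \<in> vectors \<H>" "g \<in> vectors \<H>"
  shows "\<bar>\<parallel>f\<parallel> - \<parallel>g\<parallel>\<bar> \<le> \<parallel>f - g\<parallel>"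
  using vnorm_triangle[of "f - g" g] vnorm_triangle[of "g - f" f] vnorm_minus_commute[of f g] assms
  by simp

lemma eq_of_re_ip_eq:
  assumes "f \<in> vectors \<H>" "g \<in> vectors \<H>" "\<And>h. h \<in> vectors \<H> \<Longrightarrow> \<langle>f, h\<rangle> = \<langle>g, h\<rangle>"
  shows "f = g"
proof -
  have "\<langle>f - g, f - g\<rangle> = 0"
    using assms(1,2) assms(3)[of "f - g"] by (simp add: ip_diff_left)
  then show ?thesis
    using assms ip_pos[of "f - g"] by (metis diff_closed less_irrefl right_minus_eq)
qed

lemma tendsto_ip:
  assumes "\<And>n. s n \<in> vectors \<H>" "f \<in> vectors \<H>" "g \<in> vectors \<H>"
    and "(\<lambda>n. \<parallel>s n - f\<parallel>) \<longlonglongrightarrow> 0"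
  shows "(\<lambda>n. ip \<H> (s n) g) \<longlonglongrightarrow> ip \<H> f g"
proof -
  have "(\<lambda>n. ip \<H> (s n) g - ip \<H> f g) \<longlonglongrightarrow> 0"
  proof (rule Lim_null_comparison)
    show "\<forall>\<^sub>F n in sequentially. cmod (ip \<H> (s n) g - ip \<H> f g) \<le> \<parallel>s n - f\<parallel> * \<parallel>g\<parallel>"
      using cauchy_schwarz[of "s _ - f" g] assms by (simp add: ip_diff_left)
    show "(\<lambda>n. \<parallel>s n - f\<parallel> * \<parallel>g\<parallel>) \<longlonglongrightarrow> 0"
      using tendsto_mult_right[OF assms(4), of "\<parallel>g\<parallel>"] by simp
  qed
  then show ?thesis by (rule LIM_zero_cancel)
qed

lemma tendsto_vnorm:
  assumes "\<And>n. s n \<in> vectors \<H>" "f \<in> vectors \<H>"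
    and "(\<lambda>n. \<parallel>s n - f\<parallel>) \<longlonglongrightarrow> 0"
  shows "(\<lambda>n. \<parallel>s n\<parallel>) \<longlonglongrightarrow> \<parallel>f\<parallel>"
proof -
  have "(\<lambda>n. \<parallel>s n\<parallel> - \<parallel>f\<parallel>) \<longlonglongrightarrow> 0"
    by (rule Lim_null_comparison[OF _ assms(3)]) (use abs_vnorm_diff assms in simp)
  then show ?thesis by (rule LIM_zero_cancel)
qed

text \<open>
  Limits in the space are stated through the norm of the difference, since the topology of the
  function type is that of pointwise convergence.
\<close>

lemma vlim_unique:
  assumes "\<And>n. s n \<in> vectors \<H>" "f \<in> vectors \<H>" "g \<in> vectors \<H>"
    and "(\<lambda>n. \<parallel>s n - f\<parallel>) \<longlonglongrightarrow> 0" "(\<lambda>n. \<parallel>s n - g\<parallel>) \<longlonglongrightarrow> 0"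
  shows "f = g"
proof (rule eq_of_re_ip_eq)
  fix h assume h: "h \<in> vectors \<H>"
  show "\<langle>f, h\<rangle> = \<langle>g, h\<rangle>"
    using LIMSEQ_unique[OF tendsto_ip[OF assms(1,2) h assms(4)] tendsto_ip[OF assms(1,3) h assms(5)]]
    by simp
qed fact+

lemma vlim_add:
  assumes "\<And>n. s n \<in> vectors \<H>" "f \<in> vectors \<H>" "\<And>n. u n \<in> vectors \<H>" "g \<in> vectors \<H>"
    and "(\<lambda>n. \<parallel>s n - f\<parallel>) \<longlonglongrightarrow> 0" "(\<lambda>n. \<parallel>u n - g\<parallel>) \<longlonglongrightarrow> 0"
  shows "(\<lambda>n. \<parallel>(s n + u n) - (f + g)\<parallel>) \<longlonglongrightarrow> 0"
proof (rule tendsto_sandwich[OF _ _ tendsto_const])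
  show "(\<lambda>n. \<parallel>s n - f\<parallel> + \<parallel>u n - g\<parallel>) \<longlonglongrightarrow> 0" using tendsto_add[OF assms(5,6)] by simp
  have "\<parallel>(s n + u n) - (f + g)\<parallel> \<le> \<parallel>s n - f\<parallel> + \<parallel>u n - g\<parallel>" for n
    using vnorm_triangle[of "s n - f" "u n - g"] assms(1-4) by (simp add: algebra_simps)
  then show "\<forall>\<^sub>F n in sequentially. \<parallel>(s n + u n) - (f + g)\<parallel> \<le> \<parallel>s n - f\<parallel> + \<parallel>u n - g\<parallel>" by simp
  have "0 \<le> \<parallel>(s n + u n) - (f + g)\<parallel>" for n
    using assms(1-4) by (intro vnorm_nonneg diff_closed add_closed)
  then show "\<forall>\<^sub>F n in sequentially. 0 \<le> \<parallel>(s n + u n) - (f + g)\<parallel>" by simp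
qed

lemma vlim_scale:
  assumes "\<And>n. s n \<in> vectors \<H>" "f \<in> vectors \<H>" "c \<in> scalars \<H>"
    and "(\<lambda>n. \<parallel>s n - f\<parallel>) \<longlonglongrightarrow> 0"
  shows "(\<lambda>n. \<parallel>c \<cdot> s n - c \<cdot> f\<parallel>) \<longlonglongrightarrow> 0"
proof -
  have "c \<cdot> s n - c \<cdot> f = c \<cdot> (s n - f)" for n by (simp add: fscale_def fun_eq_iff algebra_simps)
  then show ?thesis
    using tendsto_mult_left[OF assms(4), of "cmod c"] assms(1-3) by (simp add: vnorm_scale)
qed

section \<open>Bounded operators\<close>

lemma op_closed: "T \<in> bounded_ops \<H> \<Longrightarrow> f \<in> vectors \<H> \<Longrightarrow> T f \<in> vectors \<H>"
  and op_outside: "T \<in> bounded_ops \<H> \<Longrightarrow> f \<notin> vectors \<H> \<Longrightarrow> T f = 0"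
  and op_add: "T \<in> bounded_ops \<H> \<Longrightarrow> f \<in> vectors \<H> \<Longrightarrow> g \<in> vectors \<H> \<Longrightarrow> T (f + g) = T f + T g"
  and op_scale: "T \<in> bounded_ops \<H> \<Longrightarrow> c \<in> scalars \<H> \<Longrightarrow> f \<in> vectors \<H> \<Longrightarrow> T (c \<cdot> f) = c \<cdot> T f"
  by (auto simp: bounded_ops_def)

lemma op_diff:
  assumes T: "T \<in> bounded_ops \<H>" and f: "f \<in> vectors \<H>" and g: "g \<in> vectors \<H>"
  shows "T (f - g) = T f - T g"
proof -
  have "T (f - g) = T f + T ((- 1) \<cdot> g)"
    unfolding diff_conv[of f g] using f g by (intro op_add[OF T] scale_closed) simp_all
  also have "\<dots> = T f - T g"
    unfolding diff_conv[of "T f" "T g"] using op_scale[OF T _ g, of "- 1"] by simp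
  finally show ?thesis .
qed

lemma op_bound:
  assumes "T \<in> bounded_ops \<H>"
  shows "\<exists>C>0. \<forall>f\<in>vectors \<H>. \<parallel>T f\<parallel> \<le> C * \<parallel>f\<parallel>"
proof -
  obtain C where C: "\<forall>f\<in>vectors \<H>. \<parallel>T f\<parallel> \<le> C * \<parallel>f\<parallel>"
    using assms by (auto simp: bounded_ops_def)
  have "\<parallel>T f\<parallel> \<le> max C 1 * \<parallel>f\<parallel>" if "f \<in> vectors \<H>" for f
    using bspec[OF C that] mult_right_mono[of C "max C 1" "\<parallel>f\<parallel>"] that by simp
  then show ?thesis by (intro exI[of _ "max C 1"]) simp
qed

lemma bounded_opsI:
  assumes "\<And>f. f \<notin> vectors \<H> \<Longrightarrow> T f = 0" "\<And>f. f \<in> vectors \<H> \<Longrightarrow> T f \<in> vectors \<H>"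
    and "\<And>f g. f \<in> vectors \<H> \<Longrightarrow> g \<in> vectors \<H> \<Longrightarrow> T (f + g) = T f + T g"
    and "\<And>c f. c \<in> scalars \<H> \<Longrightarrow> f \<in> vectors \<H> \<Longrightarrow> T (c \<cdot> f) = c \<cdot> T f"
    and "\<And>f. f \<in> vectors \<H> \<Longrightarrow> \<parallel>T f\<parallel> \<le> C * \<parallel>f\<parallel>"
  shows "T \<in> bounded_ops \<H>"
  unfolding bounded_ops_def using assms by blast

lemma op_compose:
  assumes S: "S \<in> bounded_ops \<H>" and T: "T \<in> bounded_ops \<H>"
  shows "S \<circ> T \<in> bounded_ops \<H>"
proof -
  obtain C where C: "0 < C" "\<And>f. f \<in> vectors \<H> \<Longrightarrow> \<parallel>S f\<parallel> \<le> C * \<parallel>f\<parallel>" using op_bound[OF S] by blast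
  obtain D where D: "0 < D" "\<And>f. f \<in> vectors \<H> \<Longrightarrow> \<parallel>T f\<parallel> \<le> D * \<parallel>f\<parallel>" using op_bound[OF T] by blast
  have S0: "S 0 = 0" using op_diff[OF S zero_closed zero_closed] by simp
  show ?thesis
  proof (rule bounded_opsI[of _ "C * D"])
    fix f assume f: "f \<in> vectors \<H>"
    have "\<parallel>S (T f)\<parallel> \<le> C * \<parallel>T f\<parallel>" using C f T by (simp add: op_closed)
    also have "\<dots> \<le> C * (D * \<parallel>f\<parallel>)" using C D f by (simp add: mult_left_mono)
    finally show "\<parallel>(S \<circ> T) f\<parallel> \<le> C * D * \<parallel>f\<parallel>" by (simp add: mult_ac)
    next
    fix f g assume "f \<in> vectors \<H>" "g \<in> vectors \<H>"
    then show "(S \<circ> T) (f + g) = (S \<circ> T) f + (S \<circ> T) g"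
      using op_add[OF S, of "T f" "T g"] op_add[OF T, of f g] op_closed[OF T] by simp
  qed (use S T S0 in \<open>simp_all add: op_closed op_outside[OF T] op_scale\<close>)
qed

lemma op_minus:
  assumes S: "S \<in> bounded_ops \<H>" and T: "T \<in> bounded_ops \<H>"
  shows "S - T \<in> bounded_ops \<H>"
proof -
  obtain C where C: "0 < C" "\<And>f. f \<in> vectors \<H> \<Longrightarrow> \<parallel>S f\<parallel> \<le> C * \<parallel>f\<parallel>" using op_bound[OF S] by blast
  obtain D where D: "0 < D" "\<And>f. f \<in> vectors \<H> \<Longrightarrow> \<parallel>T f\<parallel> \<le> D * \<parallel>f\<parallel>" using op_bound[OF T] by blast
  show ?thesis
  proof (rule bounded_opsI[of _ "C + D"])
    fix f assume f: "f \<in> vectors \<H>"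
    have "\<parallel>S f - T f\<parallel> \<le> \<parallel>S f\<parallel> + \<parallel>T f\<parallel>"
      using vnorm_diff_triangle[of "S f" 0 "T f"] vnorm_minus_commute[of 0 "T f"] f S T
      by (simp add: op_closed zero_closed)
    also have "\<dots> \<le> C * \<parallel>f\<parallel> + D * \<parallel>f\<parallel>" using C D f by (intro add_mono) auto
    finally show "\<parallel>(S - T) f\<parallel> \<le> (C + D) * \<parallel>f\<parallel>" by (simp add: algebra_simps)
    next
    fix f g assume "f \<in> vectors \<H>" "g \<in> vectors \<H>"
    then show "(S - T) (f + g) = (S - T) f + (S - T) g"
      using op_add[OF S, of f g] op_add[OF T, of f g] by simp
  next
    fix c f assume "c \<in> scalars \<H>" "f \<in> vectors \<H>"
    then have "(S - T) (c \<cdot> f) = c \<cdot> S f - c \<cdot> T f"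
      using op_scale[OF S, of c f] op_scale[OF T, of c f] by simp
    then show "(S - T) (c \<cdot> f) = c \<cdot> (S - T) f"
      by (simp add: fun_eq_iff fscale_def algebra_simps)
  qed (use op_closed[OF S] op_closed[OF T] op_outside[OF S] op_outside[OF T] in auto)
qed

lemma op_zero: "T \<in> bounded_ops \<H> \<Longrightarrow> T 0 = 0"
  using op_diff[of T 0 0] zero_closed by simp

lemma op_norm_bdd_above:
  assumes T: "T \<in> bounded_ops \<H>"
  shows "bdd_above ((\<lambda>f. \<parallel>T f\<parallel>) ` {f \<in> vectors \<H>. \<parallel>f\<parallel> \<le> 1})"
proof -
  obtain C where C: "0 < C" "\<And>f. f \<in> vectors \<H> \<Longrightarrow> \<parallel>T f\<parallel> \<le> C * \<parallel>f\<parallel>" using op_bound[OF T] by blast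
  show ?thesis
  proof (rule bdd_aboveI2)
    fix g assume "g \<in> {f \<in> vectors \<H>. \<parallel>f\<parallel> \<le> 1}"
    then show "\<parallel>T g\<parallel> \<le> C" using order_trans[OF C(2)[of g] mult_left_le[of "\<parallel>g\<parallel>" C]] C(1) by auto
  qed
qed

lemma op_norm_nonneg:
  assumes T: "T \<in> bounded_ops \<H>"
  shows "0 \<le> op_norm \<H> T"
proof -
  have "\<parallel>T 0\<parallel> \<le> op_norm \<H> T"
    unfolding op_norm_def using zero_closed by (intro cSUP_upper[OF _ op_norm_bdd_above[OF T]]) simp
  then show ?thesis using op_zero[OF T] by simp
qed

lemma op_norm_upper:
  assumes T: "T \<in> bounded_ops \<H>" and f: "f \<in> vectors \<H>"
  shows "\<parallel>T f\<parallel> \<le> op_norm \<H> T * \<parallel>f\<parallel>"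
proof (cases "f = 0")
  case True
  then show ?thesis using op_zero[OF T] by simp
next
  case False
  let ?g = "complex_of_real (1 / \<parallel>f\<parallel>) \<cdot> f"
  have pos: "0 < \<parallel>f\<parallel>" using False f vnorm_pos by blast
  have g: "?g \<in> vectors \<H>" using f by (rule scale_real_closed)
  have "\<parallel>?g\<parallel> = 1" using f pos vnorm_scale_real[OF f, of "1 / \<parallel>f\<parallel>"] by simp
  then have "\<parallel>T ?g\<parallel> \<le> op_norm \<H> T"
    unfolding op_norm_def using g by (intro cSUP_upper[OF _ op_norm_bdd_above[OF T]]) auto
  moreover have "\<parallel>T ?g\<parallel> = (1 / \<parallel>f\<parallel>) * \<parallel>T f\<parallel>"
    using f pos T vnorm_scale_real[of "T f" "1 / \<parallel>f\<parallel>"] op_scale[OF T real_scalar f, of "1 / \<parallel>f\<parallel>"]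
    by (simp add: op_closed)
  ultimately show ?thesis using pos by (simp add: pos_divide_le_eq del: of_real_divide)
qed

lemma op_norm_least:
  assumes "\<And>f. f \<in> vectors \<H> \<Longrightarrow> \<parallel>T f\<parallel> \<le> C * \<parallel>f\<parallel>" "0 \<le> C"
  shows "op_norm \<H> T \<le> C"
  unfolding op_norm_def
proof (rule cSUP_least)
  show "{f \<in> vectors \<H>. \<parallel>f\<parallel> \<le> 1} \<noteq> {}" using zero_closed vnorm_zero by force
  fix f assume "f \<in> {f \<in> vectors \<H>. \<parallel>f\<parallel> \<le> 1}"
  then show "\<parallel>T f\<parallel> \<le> C" using assms(1)[of f] mult_left_mono[of "\<parallel>f\<parallel>" 1 C] assms(2) by auto
qed

section \<open>Representing vectors and adjoints\<close>

definition self_adjoint :: "(('o \<Rightarrow> complex) \<Rightarrow> 'o \<Rightarrow> complex) \<Rightarrow> bool"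
  where "self_adjoint T \<longleftrightarrow> T \<in> bounded_ops \<H> \<and>
    (\<forall>f\<in>vectors \<H>. \<forall>g\<in>vectors \<H>. ip \<H> (T f) g = ip \<H> f (T g))"

lemma self_adjoint_bounded: "self_adjoint T \<Longrightarrow> T \<in> bounded_ops \<H>"
  and self_adjoint_ip:
    "self_adjoint T \<Longrightarrow> f \<in> vectors \<H> \<Longrightarrow> g \<in> vectors \<H> \<Longrightarrow> ip \<H> (T f) g = ip \<H> f (T g)"
  by (auto simp: self_adjoint_def)

text \<open>
  Over \<open>\<complex>\<close> the imaginary part of a linear functional at \<open>f\<close> is determined by its real part at
  \<open>\<i> \<cdot> f\<close>; over \<open>\<real>\<close> there is no imaginary part.
\<close>

lemma scalar_eq_of_re_ip_eq:
  assumes "\<And>f. f \<in> vectors \<H> \<Longrightarrow> \<phi> f \<in> scalars \<H>"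
    and "\<And>c f. c \<in> scalars \<H> \<Longrightarrow> f \<in> vectors \<H> \<Longrightarrow> \<phi> (c \<cdot> f) = c * \<phi> f"
    and "g \<in> vectors \<H>" "\<And>f. f \<in> vectors \<H> \<Longrightarrow> Re (\<phi> f) = \<langle>f, g\<rangle>" "f \<in> vectors \<H>"
  shows "\<phi> f = ip \<H> f g"
proof (cases "scalars \<H> = UNIV")
  case True
  have "Re (\<phi> (\<i> \<cdot> f)) = \<langle>\<i> \<cdot> f, g\<rangle>"
    using True assms(4)[of "\<i> \<cdot> f"] assms(5) scale_closed[of "\<i>" f] by blast
  then have "Im (\<phi> f) = Im (ip \<H> f g)"
    using True assms(2)[of "\<i>" f] ip_scale[of "\<i>" f g] assms(3,5) by simp
  then show ?thesis using assms(4,5) by (simp add: complex_eq_iff)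
next
  case False
  then have "\<phi> f \<in> \<real>" "ip \<H> f g \<in> \<real>"
    using scalars assms(1)[of f] ip_scalar[of f g] assms(3,5) by auto
  then show ?thesis using assms(4,5) by (auto simp: complex_eq_iff complex_is_Real_iff)
qed

text \<open>
  The functional \<open>J f = \<langle>S f, f\<rangle> - 2 * Re (\<phi> f)\<close> is bounded from below by coercivity, and its
  minimising sequences are Cauchy. At the limit \<open>g\<close> of such a sequence the derivative of \<open>J\<close> vanishes in each
  direction \<open>h\<close>, that is, \<open>Re (\<phi> h) = \<langle>h, S g\<rangle>\<close>. With the identity for \<open>S\<close> this is the Riesz representation
  theorem, and with \<open>\<phi> f = ip \<H> f y\<close> it solves \<open>S g = y\<close>.
\<close>

lemma coercive_representation:
  fixes \<phi> :: "('o \<Rightarrow> complex) \<Rightarrow> complex"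
  assumes S: "self_adjoint S"
    and c: "0 < c" "\<And>f. f \<in> vectors \<H> \<Longrightarrow> c * \<parallel>f\<parallel>\<^sup>2 \<le> \<langle>S f, f\<rangle>"
    and \<phi>_add: "\<And>f g. f \<in> vectors \<H> \<Longrightarrow> g \<in> vectors \<H> \<Longrightarrow> \<phi> (f + g) = \<phi> f + \<phi> g"
    and \<phi>_scale: "\<And>c f. c \<in> scalars \<H> \<Longrightarrow> f \<in> vectors \<H> \<Longrightarrow> \<phi> (c \<cdot> f) = c * \<phi> f"
    and \<phi>_scalar: "\<And>f. f \<in> vectors \<H> \<Longrightarrow> \<phi> f \<in> scalars \<H>"
    and \<phi>_bound: "\<And>f. f \<in> vectors \<H> \<Longrightarrow> cmod (\<phi> f) \<le> K * \<parallel>f\<parallel>"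
  shows "\<exists>g\<in>vectors \<H>. \<forall>f\<in>vectors \<H>. \<phi> f = ip \<H> f (S g)"
proof -
  note SB = self_adjoint_bounded[OF S]
  have Scl: "S f \<in> vectors \<H>" if "f \<in> vectors \<H>" for f using op_closed[OF SB that] .
  define J where "J f = \<langle>S f, f\<rangle> - 2 * Re (\<phi> f)" for f
  \<comment> \<open>Along a line, \<open>J\<close> is a quadratic polynomial; a minimiser \<open>g\<close> satisfies \<open>Re (\<phi> h) = \<langle>g, S h\<rangle>\<close>.\<close>
  have J_shift: "J (f + complex_of_real t \<cdot> h)
      = J f + 2 * t * (\<langle>f, S h\<rangle> - Re (\<phi> h)) + t\<^sup>2 * \<langle>S h, h\<rangle>"
    if f: "f \<in> vectors \<H>" and h: "h \<in> vectors \<H>" for f h t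
  proof -
    have "S (f + complex_of_real t \<cdot> h) = S f + complex_of_real t \<cdot> S h"
      using op_add[OF SB f scale_real_closed[OF h]] op_scale[OF SB real_scalar h] by simp
    moreover have "\<langle>S f, h\<rangle> = \<langle>f, S h\<rangle>" "\<langle>S h, f\<rangle> = \<langle>f, S h\<rangle>"
      using self_adjoint_ip[OF S f h] re_ip_commute[OF f Scl[OF h]] by simp_all
    ultimately show ?thesis
      using f h Scl unfolding J_def
      by (simp add: ip_simps closed \<phi>_add \<phi>_scale algebra_simps power2_eq_square)
  qed
  have "- (K\<^sup>2 / c) \<le> J f" if f: "f \<in> vectors \<H>" for f
  proof -
    have "Re (\<phi> f) \<le> K * \<parallel>f\<parallel>"
      using \<phi>_bound[OF f] complex_Re_le_cmod[of "\<phi> f"] by linarith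
    moreover have "0 \<le> (c * \<parallel>f\<parallel> - K)\<^sup>2 / c" using c by simp
    then have "0 \<le> c * \<parallel>f\<parallel>\<^sup>2 - 2 * (K * \<parallel>f\<parallel>) + K\<^sup>2 / c"
      using c by (simp add: power2_eq_square field_simps)
    ultimately show ?thesis using c(2)[OF f] unfolding J_def by linarith
  qed
  then have bdd: "bdd_below (J ` vectors \<H>)" by (intro bdd_belowI2)
  define m where "m = (INF f\<in>vectors \<H>. J f)"
  have m_le: "m \<le> J f" if "f \<in> vectors \<H>" for f
    unfolding m_def using that by (rule cINF_lower[OF bdd])
  have "\<exists>f\<in>vectors \<H>. J f < m + 1 / (real n + 1)" for n
  proof -
    have "(INF f\<in>vectors \<H>. J f) < m + 1 / (real n + 1)" unfolding m_def by simp
    then show ?thesis using cINF_less_iff[of "vectors \<H>" J] bdd zero_closed by blast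
  qed
  then obtain s where s: "\<And>n. s n \<in> vectors \<H>" "\<And>n. J (s n) < m + 1 / (real n + 1)"
    by metis
  \<comment> \<open>A minimising sequence is Cauchy: compare \<open>J\<close> at two of its terms with \<open>J\<close> at their midpoint.\<close>
  have close: "c * \<parallel>s p - s q\<parallel>\<^sup>2 \<le> 2 / (real p + 1) + 2 / (real q + 1)" for p q
  proof -
    let ?d = "s p - s q"
    have d: "?d \<in> vectors \<H>" using s by simp
    have sp: "s p = s q + complex_of_real 1 \<cdot> ?d"
      by (simp add: fscale_def fun_eq_iff)
    have mid: "s q + complex_of_real (1 / 2) \<cdot> ?d \<in> vectors \<H>"
      by (rule add_closed[OF s(1) scale_real_closed[OF d]])
    have "J (s p) = J (s q) + 2 * (\<langle>s q, S ?d\<rangle> - Re (\<phi> ?d)) + \<langle>S ?d, ?d\<rangle>"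
      using J_shift[OF s(1)[of q] d, of 1] sp by simp
    moreover have "J (s q + complex_of_real (1 / 2) \<cdot> ?d)
        = J (s q) + (\<langle>s q, S ?d\<rangle> - Re (\<phi> ?d)) + \<langle>S ?d, ?d\<rangle> / 4"
      using J_shift[OF s(1)[of q] d, of "1 / 2"] by (simp add: power2_eq_square)
    moreover have "q = 2 * x + 2 * y - 4 * z" if "x = y + 2 * b + q" "z = y + b + q / 4"
      for q x y z b :: real using that by linarith
    ultimately have "\<langle>S ?d, ?d\<rangle>
        = 2 * J (s p) + 2 * J (s q) - 4 * J (s q + complex_of_real (1 / 2) \<cdot> ?d)"
      by blast
    then show ?thesis
      using c(2)[OF d] m_le[OF mid] s(2)[of p] s(2)[of q] by linarith
  qed
  have "\<exists>N. \<forall>p\<ge>N. \<forall>q\<ge>N. \<parallel>s p - s q\<parallel> < e" if e: "0 < e" for e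
  proof -
    obtain N :: nat where N: "4 / (c * e\<^sup>2) < real N" using reals_Archimedean2 by blast
    have "\<parallel>s p - s q\<parallel> < e" if pq: "p \<ge> N" "q \<ge> N" for p q
    proof -
      have N0: "0 < real N" using N c e by (meson divide_pos_pos less_trans mult_pos_pos zero_less_numeral zero_less_power)
      have "2 / (real p + 1) \<le> 2 / real N" "2 / (real q + 1) \<le> 2 / real N"
        using pq N0 by (auto intro!: divide_left_mono)
      moreover have "4 / real N < c * e\<^sup>2"
        using N N0 c e by (simp add: divide_less_eq mult.commute)
      moreover have "4 / real N = 2 / real N + 2 / real N" by simp
      ultimately have "c * \<parallel>s p - s q\<parallel>\<^sup>2 < c * e\<^sup>2" using close[of p q] by linarith
      then have "\<parallel>s p - s q\<parallel>\<^sup>2 < e\<^sup>2" using c by simp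
      then show ?thesis using e by (simp add: power_less_imp_less_base)
    qed
    then show ?thesis by blast
  qed
  then obtain g where g: "g \<in> vectors \<H>" "(\<lambda>n. \<parallel>s n - g\<parallel>) \<longlonglongrightarrow> 0"
    using complete[of s] s(1) by blast
  have "Re (\<phi> h) = \<langle>h, S g\<rangle>" if h: "h \<in> vectors \<H>" for h
  proof -
    let ?b = "\<langle>g, S h\<rangle> - Re (\<phi> h)"
    have "0 \<le> 0 + 2 * t * ?b + t\<^sup>2 * \<langle>S h, h\<rangle>" for t
    proof (rule tendsto_lowerbound)
      have lim: "(\<lambda>n. 1 / (real n + 1)) \<longlonglongrightarrow> 0"
        using LIMSEQ_inverse_real_of_nat by (simp add: inverse_eq_divide add.commute)
      show "(\<lambda>n. 1 / (real n + 1) + 2 * t * (\<langle>s n, S h\<rangle> - Re (\<phi> h)) + t\<^sup>2 * \<langle>S h, h\<rangle>)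
          \<longlonglongrightarrow> 0 + 2 * t * ?b + t\<^sup>2 * \<langle>S h, h\<rangle>"
        by (intro tendsto_intros lim tendsto_ip s g Scl h)
      have "0 \<le> 1 / (real n + 1) + 2 * t * (\<langle>s n, S h\<rangle> - Re (\<phi> h)) + t\<^sup>2 * \<langle>S h, h\<rangle>" for n
        using J_shift[OF s(1) h, of n t] s(2)[of n]
          m_le[OF add_closed[OF s(1) scale_real_closed[OF h]], of n t] by linarith
      then show "\<forall>\<^sub>F n in sequentially.
          0 \<le> 1 / (real n + 1) + 2 * t * (\<langle>s n, S h\<rangle> - Re (\<phi> h)) + t\<^sup>2 * \<langle>S h, h\<rangle>"
        by simp
    qed simp
    moreover have "0 \<le> \<langle>S h, h\<rangle>"
      using c(2)[OF h] c(1) by (meson dual_order.trans mult_nonneg_nonneg less_imp_le zero_le_power2)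
    ultimately have "?b\<^sup>2 \<le> 0" using discriminant_bound[of 0 ?b "\<langle>S h, h\<rangle>"] by simp
    then have "Re (\<phi> h) = \<langle>g, S h\<rangle>" by simp
    also have "\<dots> = \<langle>h, S g\<rangle>"
      using self_adjoint_ip[OF S h g(1)] re_ip_commute[OF g(1) Scl[OF h]] by simp
    finally show ?thesis .
  qed
  then show ?thesis
    using scalar_eq_of_re_ip_eq[of \<phi> "S g"] g(1) Scl \<phi>_scale \<phi>_scalar by blast
qed

text \<open>
  Operators vanish outside the space, so the identity function does not represent the
  identity operator.
\<close>

definition id_op :: "('o \<Rightarrow> complex) \<Rightarrow> 'o \<Rightarrow> complex"
  where "id_op f = (if f \<in> vectors \<H> then f else 0)"

lemma id_op_apply [simp]: "f \<in> vectors \<H> \<Longrightarrow> id_op f = f"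
  by (simp add: id_op_def)

lemma id_op_bounded: "id_op \<in> bounded_ops \<H>"
  by (rule bounded_opsI[of _ 1]) (simp_all add: closed, simp add: id_op_def)

lemma id_op_self_adjoint: "self_adjoint id_op"
  by (simp add: self_adjoint_def id_op_bounded)

theorem riesz_representation:
  assumes "\<And>f g. f \<in> vectors \<H> \<Longrightarrow> g \<in> vectors \<H> \<Longrightarrow> \<phi> (f + g) = \<phi> f + \<phi> g"
    and "\<And>c f. c \<in> scalars \<H> \<Longrightarrow> f \<in> vectors \<H> \<Longrightarrow> \<phi> (c \<cdot> f) = c * \<phi> f"
    and "\<And>f. f \<in> vectors \<H> \<Longrightarrow> \<phi> f \<in> scalars \<H>"
    and "\<And>f. f \<in> vectors \<H> \<Longrightarrow> cmod (\<phi> f) \<le> K * \<parallel>f\<parallel>"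
  shows "\<exists>g\<in>vectors \<H>. \<forall>f\<in>vectors \<H>. \<phi> f = ip \<H> f g"
proof -
  have "\<exists>g\<in>vectors \<H>. \<forall>f\<in>vectors \<H>. \<phi> f = ip \<H> f (id_op g)"
    by (rule coercive_representation[OF id_op_self_adjoint, of 1 \<phi> K]) (use assms in \<open>simp_all add: vnorm_sq\<close>)
  then show ?thesis by auto
qed

lemma eq_of_ip_eq_right:
  assumes "f \<in> vectors \<H>" "g \<in> vectors \<H>" "\<And>h. h \<in> vectors \<H> \<Longrightarrow> ip \<H> h f = ip \<H> h g"
  shows "f = g"
  using assms re_ip_commute by (intro eq_of_re_ip_eq) simp_all

lemma rep_kernel_closed:
  assumes x: "x \<in> points \<H>"
  shows "rep_kernel \<H> x \<in> vectors \<H>"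
proof -
  obtain C where "\<forall>f\<in>vectors \<H>. cmod (f x) \<le> C * \<parallel>f\<parallel>" using eval_bounded[OF x] by blast
  then have "\<exists>k\<in>vectors \<H>. \<forall>f\<in>vectors \<H>. f x = ip \<H> f k"
    using x by (intro riesz_representation[of "\<lambda>f. f x" C]) (simp_all add: fscale_def range)
  moreover have "k = k'" if "k \<in> vectors \<H> \<and> (\<forall>f\<in>vectors \<H>. f x = ip \<H> f k)"
    "k' \<in> vectors \<H> \<and> (\<forall>f\<in>vectors \<H>. f x = ip \<H> f k')" for k k'
    using that by (intro eq_of_ip_eq_right) auto
  ultimately have "\<exists>!k. k \<in> vectors \<H> \<and> (\<forall>f\<in>vectors \<H>. f x = ip \<H> f k)" by blast
  from theI'[OF this] show ?thesis by (simp add: rep_kernel_def)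
qed

lemma normalized_kernel:
  assumes "x \<in> points \<H>" "rep_kernel \<H> x \<noteq> 0"
  shows "normalized_kernel \<H> x \<in> vectors \<H>" "\<parallel>normalized_kernel \<H> x\<parallel> = 1"
proof -
  note k = rep_kernel_closed[OF assms(1)]
  show "normalized_kernel \<H> x \<in> vectors \<H>"
    unfolding normalized_kernel_def by (rule scale_real_closed[OF k])
  show "\<parallel>normalized_kernel \<H> x\<parallel> = 1"
    unfolding normalized_kernel_def vnorm_scale_real[OF k] using vnorm_pos[OF k assms(2)] by simp
qed

text \<open>
  \<open>B g\<close> is the vector that represents the functional \<open>f \<mapsto> ip \<H> (A f) g\<close>. Testing against all \<open>f\<close> shows
  linearity, and testing against \<open>B g\<close> itself shows boundedness.
\<close>

theorem adjoint_op_unique_existence: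
  assumes A: "A \<in> bounded_ops \<H>"
  shows "\<exists>!B. B \<in> bounded_ops \<H> \<and>
    (\<forall>f\<in>vectors \<H>. \<forall>g\<in>vectors \<H>. ip \<H> (A f) g = ip \<H> f (B g))"
proof -
  obtain C where C: "0 < C" "\<And>f. f \<in> vectors \<H> \<Longrightarrow> \<parallel>A f\<parallel> \<le> C * \<parallel>f\<parallel>"
    using op_bound[OF A] by blast
  note Acl = op_closed[OF A]
  have "\<exists>b\<in>vectors \<H>. \<forall>f\<in>vectors \<H>. ip \<H> (A f) g = ip \<H> f b" if g: "g \<in> vectors \<H>" for g
  proof (rule riesz_representation[of "\<lambda>f. ip \<H> (A f) g" "C * \<parallel>g\<parallel>"])
    fix f assume f: "f \<in> vectors \<H>"
    have "cmod (ip \<H> (A f) g) \<le> \<parallel>A f\<parallel> * \<parallel>g\<parallel>" using Acl f g by (simp add: cauchy_schwarz)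
    also have "\<dots> \<le> C * \<parallel>f\<parallel> * \<parallel>g\<parallel>" using C(2)[OF f] g by (simp add: mult_right_mono)
    finally show "cmod (ip \<H> (A f) g) \<le> C * \<parallel>g\<parallel> * \<parallel>f\<parallel>" by (simp add: mult_ac)
  qed (use g Acl op_add[OF A] op_scale[OF A] in \<open>simp_all add: ip_add ip_scale ip_scalar\<close>)
  then obtain b where b: "\<And>g. g \<in> vectors \<H> \<Longrightarrow> b g \<in> vectors \<H>"
    "\<And>f g. f \<in> vectors \<H> \<Longrightarrow> g \<in> vectors \<H> \<Longrightarrow> ip \<H> (A f) g = ip \<H> f (b g)"
    by metis
  define B where "B g = (if g \<in> vectors \<H> then b g else 0)" for g
  have Bcl: "B g \<in> vectors \<H>" and B: "ip \<H> (A f) g = ip \<H> f (B g)"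
    if "f \<in> vectors \<H>" "g \<in> vectors \<H>" for f g
    using that b by (simp_all add: B_def)
  have "B \<in> bounded_ops \<H>"
  proof (rule bounded_opsI[of _ C])
    fix g h assume gh: "g \<in> vectors \<H>" "h \<in> vectors \<H>"
    show "B (g + h) = B g + B h"
    proof (rule eq_of_ip_eq_right)
      fix k assume k: "k \<in> vectors \<H>"
      show "ip \<H> k (B (g + h)) = ip \<H> k (B g + B h)"
        using gh k Acl Bcl B[OF k gh(1), symmetric] B[OF k gh(2), symmetric]
          B[OF k add_closed[OF gh], symmetric]
        by (simp add: ip_add_right)
    qed (use gh Bcl in \<open>simp_all add: closed\<close>)
  next
    fix c g assume c: "c \<in> scalars \<H>" and g: "g \<in> vectors \<H>"
    show "B (c \<cdot> g) = c \<cdot> B g"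
    proof (rule eq_of_ip_eq_right)
      fix k assume k: "k \<in> vectors \<H>"
      show "ip \<H> k (B (c \<cdot> g)) = ip \<H> k (c \<cdot> B g)"
        using c g k Acl Bcl B[OF k g, symmetric] B[OF k scale_closed[OF c g], symmetric]
        by (simp add: ip_scale_right)
    qed (use c g Bcl in \<open>simp_all add: closed\<close>)
  next
    fix g assume g: "g \<in> vectors \<H>"
    have Bg: "B g \<in> vectors \<H>" using g Bcl by blast
    have "\<parallel>B g\<parallel>\<^sup>2 = \<langle>A (B g), g\<rangle>" using B[OF Bg g] Bg by (simp add: vnorm_sq)
    also have "\<dots> \<le> \<parallel>A (B g)\<parallel> * \<parallel>g\<parallel>" using Acl[OF Bg] g by (rule re_ip_le)
    also have "\<dots> \<le> C * \<parallel>B g\<parallel> * \<parallel>g\<parallel>" using C(2)[OF Bg] g by (simp add: mult_right_mono)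
    finally have "\<parallel>B g\<parallel> * \<parallel>B g\<parallel> \<le> \<parallel>B g\<parallel> * (C * \<parallel>g\<parallel>)" by (simp add: power2_eq_square mult_ac)
    then show "\<parallel>B g\<parallel> \<le> C * \<parallel>g\<parallel>"
      using vnorm_nonneg[OF Bg] vnorm_nonneg[OF g] C(1)
      by (cases "\<parallel>B g\<parallel> = 0") (simp_all add: mult_le_cancel_left)
  qed (use Bcl in \<open>simp_all add: B_def\<close>)
  then have "B \<in> bounded_ops \<H> \<and>
      (\<forall>f\<in>vectors \<H>. \<forall>g\<in>vectors \<H>. ip \<H> (A f) g = ip \<H> f (B g))"
    using B by blast
  moreover have "B' = B''"
    if B': "B' \<in> bounded_ops \<H> \<and>
        (\<forall>f\<in>vectors \<H>. \<forall>g\<in>vectors \<H>. ip \<H> (A f) g = ip \<H> f (B' g))"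
      and B'': "B'' \<in> bounded_ops \<H> \<and>
        (\<forall>f\<in>vectors \<H>. \<forall>g\<in>vectors \<H>. ip \<H> (A f) g = ip \<H> f (B'' g))" for B' B''
  proof
    fix g show "B' g = B'' g"
    proof (cases "g \<in> vectors \<H>")
      case True
      have "B' g \<in> vectors \<H>" "B'' g \<in> vectors \<H>" using True B' B'' op_closed by blast+
      moreover have "ip \<H> h (B' g) = ip \<H> h (B'' g)" if "h \<in> vectors \<H>" for h
        using that True B' B'' by metis
      ultimately show ?thesis by (rule eq_of_ip_eq_right)
    next
      case False
      then show ?thesis using B' B'' op_outside[of B' g] op_outside[of B'' g] by simp
    qed
  qed
  ultimately show ?thesis by blast
qed

lemma adjoint_bounded: "A \<in> bounded_ops \<H> \<Longrightarrow> adjoint_op \<H> A \<in> bounded_ops \<H>"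
  and adjoint_ip: "A \<in> bounded_ops \<H> \<Longrightarrow> f \<in> vectors \<H> \<Longrightarrow> g \<in> vectors \<H> \<Longrightarrow>
    ip \<H> (A f) g = ip \<H> f (adjoint_op \<H> A g)"
  using theI'[OF adjoint_op_unique_existence, of A] by (auto simp: adjoint_op_def)

lemma adjoint_ip': "A \<in> bounded_ops \<H> \<Longrightarrow> f \<in> vectors \<H> \<Longrightarrow> g \<in> vectors \<H> \<Longrightarrow>
    ip \<H> (adjoint_op \<H> A f) g = ip \<H> f (A g)"
  using adjoint_ip[of A g f] ip_commute[of "A g" f] ip_commute[of g "adjoint_op \<H> A f"]
  by (simp add: op_closed adjoint_bounded)

lemma adjoint_compose_self:
  assumes A: "A \<in> bounded_ops \<H>"
  shows "self_adjoint (adjoint_op \<H> A \<circ> A)"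
    and "f \<in> vectors \<H> \<Longrightarrow> \<langle>(adjoint_op \<H> A \<circ> A) f, f\<rangle> = \<parallel>A f\<parallel>\<^sup>2"
  using A by (simp_all add: self_adjoint_def op_compose adjoint_bounded adjoint_ip' op_closed
      vnorm_sq flip: adjoint_ip)

section \<open>Polynomials in an operator\<close>

lemma op_linear_combination:
  assumes S: "S \<in> bounded_ops \<H>" and T: "T \<in> bounded_ops \<H>"
  shows "(\<lambda>f. complex_of_real a \<cdot> S f + complex_of_real b \<cdot> T f) \<in> bounded_ops \<H>"
proof -
  obtain C where C: "0 < C" "\<And>f. f \<in> vectors \<H> \<Longrightarrow> \<parallel>S f\<parallel> \<le> C * \<parallel>f\<parallel>" using op_bound[OF S] by blast
  obtain D where D: "0 < D" "\<And>f. f \<in> vectors \<H> \<Longrightarrow> \<parallel>T f\<parallel> \<le> D * \<parallel>f\<parallel>" using op_bound[OF T] by blast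
  note cl = op_closed[OF S] op_closed[OF T]
  show ?thesis
  proof (rule bounded_opsI[of _ "\<bar>a\<bar> * C + \<bar>b\<bar> * D"])
    fix f assume f: "f \<in> vectors \<H>"
    have "\<parallel>complex_of_real a \<cdot> S f + complex_of_real b \<cdot> T f\<parallel> \<le> \<bar>a\<bar> * \<parallel>S f\<parallel> + \<bar>b\<bar> * \<parallel>T f\<parallel>"
      using vnorm_triangle[of "complex_of_real a \<cdot> S f" "complex_of_real b \<cdot> T f"] cl f
      by (simp add: vnorm_scale_real)
    also have "\<dots> \<le> \<bar>a\<bar> * (C * \<parallel>f\<parallel>) + \<bar>b\<bar> * (D * \<parallel>f\<parallel>)"
      using C(2)[OF f] D(2)[OF f] by (intro add_mono mult_left_mono) auto
    finally show "\<parallel>complex_of_real a \<cdot> S f + complex_of_real b \<cdot> T f\<parallel> \<le> (\<bar>a\<bar> * C + \<bar>b\<bar> * D) * \<parallel>f\<parallel>"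
      by (simp add: algebra_simps)
  qed (use cl op_outside[OF S] op_outside[OF T] op_add[OF S] op_add[OF T] op_scale[OF S] op_scale[OF T]
       in \<open>auto simp: closed fscale_simps mult.commute add_ac\<close>)
qed

lemma poly_op_outside: "f \<notin> vectors \<H> \<Longrightarrow> poly_op \<H> p T f = 0"
  by (simp add: poly_op_def)

text \<open>
  Raising the upper summation bound lets polynomials of different degrees be added termwise.
\<close>

lemma poly_op_sum:
  assumes "f \<in> vectors \<H>" "degree p \<le> n"
  shows "poly_op \<H> p T f = (\<Sum>i\<le>n. complex_of_real (coeff p i) \<cdot> (T ^^ i) f)"
proof -
  have "(\<Sum>i\<le>n. complex_of_real (coeff p i) \<cdot> (T ^^ i) f)
      = (\<Sum>i\<le>degree p. complex_of_real (coeff p i) \<cdot> (T ^^ i) f)"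
    using assms(2) by (intro sum.mono_neutral_right) (auto simp: coeff_eq_0 fscale_simps)
  then show ?thesis using assms(1) by (simp add: poly_op_def)
qed

lemma poly_op_0 [simp]: "poly_op \<H> 0 T f = 0"
  by (simp add: poly_op_def fscale_simps)

lemma poly_op_add:
  assumes "f \<in> vectors \<H>"
  shows "poly_op \<H> (p + q) T f = poly_op \<H> p T f + poly_op \<H> q T f"
  using assms poly_op_sum[of f _ "max (degree p) (degree q)"] degree_add_le_max[of p q]
  by (simp add: fscale_simps sum.distrib)

lemma poly_op_smult:
  assumes "f \<in> vectors \<H>"
  shows "poly_op \<H> (smult a p) T f = complex_of_real a \<cdot> poly_op \<H> p T f"
proof -
  from fscale_sum[of "complex_of_real a" "\<lambda>i. complex_of_real (coeff p i) \<cdot> (T ^^ i) f" "{..degree p}"] show ?thesis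
    using assms poly_op_sum[of f _ "degree p"] degree_smult_le[of a p]
    by (simp add: fscale_simps)
qed

lemma poly_op_diff:
  assumes "f \<in> vectors \<H>"
  shows "poly_op \<H> (p - q) T f = poly_op \<H> p T f - poly_op \<H> q T f"
  using assms poly_op_sum[of f _ "max (degree p) (degree q)"] degree_diff_le_max[of p q]
  by (simp add: fscale_simps sum_subtractf)

context
  fixes T :: "('o \<Rightarrow> complex) \<Rightarrow> 'o \<Rightarrow> complex"
  assumes T: "T \<in> bounded_ops \<H>"
begin

text \<open>
  The Horner form of \<open>p(T)\<close>, which makes the algebraic rules below accessible to induction on \<open>p\<close>.
\<close>

lemma poly_op_pCons:
  assumes f: "f \<in> vectors \<H>"
  shows "poly_op \<H> (pCons a p) T f = complex_of_real a \<cdot> f + T (poly_op \<H> p T f)"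
proof -
  have pow: "(T ^^ i) f \<in> vectors \<H>" for i
    by (induction i) (use f op_closed[OF T] in auto)
  have sum_closed: "(\<Sum>i\<le>n. complex_of_real (coeff p i) \<cdot> (T ^^ i) f) \<in> vectors \<H>" for n
  proof (induction n)
    case 0
    show "(\<Sum>i\<le>0. complex_of_real (coeff p i) \<cdot> (T ^^ i) f) \<in> vectors \<H>" using f by simp
  next
    case (Suc n)
    then show "(\<Sum>i\<le>Suc n. complex_of_real (coeff p i) \<cdot> (T ^^ i) f) \<in> vectors \<H>"
      using add_closed[OF Suc scale_real_closed[OF pow[of "Suc n"], of "coeff p (Suc n)"]] by simp
  qed
  have T_sum: "T (\<Sum>i\<le>n. complex_of_real (coeff p i) \<cdot> (T ^^ i) f)
      = (\<Sum>i\<le>n. complex_of_real (coeff p i) \<cdot> T ((T ^^ i) f))" for n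
  proof (induction n)
    case 0
    show ?case using op_scale[OF T real_scalar f] by simp
  next
    case (Suc n)
    have "T (complex_of_real (coeff p (Suc n)) \<cdot> (T ^^ Suc n) f)
        = complex_of_real (coeff p (Suc n)) \<cdot> T ((T ^^ Suc n) f)"
      by (rule op_scale[OF T real_scalar pow])
    then show "T (\<Sum>i\<le>Suc n. complex_of_real (coeff p i) \<cdot> (T ^^ i) f)
        = (\<Sum>i\<le>Suc n. complex_of_real (coeff p i) \<cdot> T ((T ^^ i) f))"
      using op_add[OF T sum_closed[of n] scale_real_closed[OF pow[of "Suc n"], of "coeff p (Suc n)"]] Suc
      by simp
  qed
  have "poly_op \<H> (pCons a p) T f
      = (\<Sum>i\<le>Suc (degree p). complex_of_real (coeff (pCons a p) i) \<cdot> (T ^^ i) f)"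
    by (rule poly_op_sum[OF f degree_pCons_le])
  also have "\<dots> = complex_of_real a \<cdot> f + (\<Sum>i\<le>degree p. complex_of_real (coeff p i) \<cdot> T ((T ^^ i) f))"
    by (simp add: sum.atMost_Suc_shift del: sum.atMost_Suc)
  finally show ?thesis
    using T_sum[of "degree p"] poly_op_sum[OF f order_refl, of p T] by simp
qed

lemma poly_op_bounded: "poly_op \<H> p T \<in> bounded_ops \<H>"
proof (induction p)
  case 0
  have "poly_op \<H> 0 T = (\<lambda>f. complex_of_real 0 \<cdot> id_op f + complex_of_real 0 \<cdot> id_op f)"
    by (rule ext) (simp add: fscale_simps)
  then show ?case using op_linear_combination[OF id_op_bounded id_op_bounded] by metis
next
  case (pCons a p)
  have "poly_op \<H> (pCons a p) T
      = (\<lambda>f. complex_of_real a \<cdot> id_op f + complex_of_real 1 \<cdot> (T \<circ> poly_op \<H> p T) f)"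
  proof
    fix f
    have "T 0 = 0" using op_diff[OF T zero_closed zero_closed] by simp
    then show "poly_op \<H> (pCons a p) T f
        = complex_of_real a \<cdot> id_op f + complex_of_real 1 \<cdot> (T \<circ> poly_op \<H> p T) f"
      by (cases "f \<in> vectors \<H>") (simp_all add: poly_op_pCons poly_op_outside id_op_def fscale_simps)
  qed
  then show ?case using pCons op_linear_combination[OF id_op_bounded op_compose[OF T]] by metis
qed

lemmas poly_op_closed [simp] = op_closed[OF poly_op_bounded]

lemma poly_op_const: "f \<in> vectors \<H> \<Longrightarrow> poly_op \<H> [:a:] T f = complex_of_real a \<cdot> f"
  using op_diff[OF T zero_closed zero_closed] by (simp add: poly_op_pCons)

lemma poly_op_linear:
  "f \<in> vectors \<H> \<Longrightarrow> poly_op \<H> [:a, b:] T f = complex_of_real a \<cdot> f + complex_of_real b \<cdot> T f"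
  using op_scale[OF T real_scalar, of f b] by (simp add: poly_op_pCons[of f a] poly_op_const)

lemma poly_op_mult:
  "f \<in> vectors \<H> \<Longrightarrow> poly_op \<H> (p * q) T f = poly_op \<H> p T (poly_op \<H> q T f)"
  by (induction p) (simp_all add: poly_op_add poly_op_smult poly_op_pCons fscale_simps)

end

lemma poly_op_self_adjoint:
  assumes T: "self_adjoint T"
  shows "self_adjoint (poly_op \<H> p T)"
proof -
  note TB = self_adjoint_bounded[OF T]
  have "ip \<H> (poly_op \<H> p T f) g = ip \<H> f (poly_op \<H> p T g)"
    if f: "f \<in> vectors \<H>" and g: "g \<in> vectors \<H>" for f g
    using f g
  proof (induction p arbitrary: f)
    case (pCons a p)
    note fg = pCons.prems and cl = op_closed[OF TB] poly_op_closed[OF TB]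
    have "poly_op \<H> p T (T f) = T (poly_op \<H> p T f)"
      using poly_op_mult[OF TB fg(1), of p "[:0, 1:]"] poly_op_mult[OF TB fg(1), of "[:0, 1:]" p] fg cl
      by (simp add: poly_op_linear[OF TB] fscale_simps mult.commute)
    then have "ip \<H> (T (poly_op \<H> p T f)) g = ip \<H> f (T (poly_op \<H> p T g))"
      using pCons.IH[of "T f"] self_adjoint_ip[OF T fg(1), of "poly_op \<H> p T g"] fg cl by simp
    then show "ip \<H> (poly_op \<H> (pCons a p) T f) g = ip \<H> f (poly_op \<H> (pCons a p) T g)"
      using fg cl by (simp add: poly_op_pCons[OF TB] ip_simps closed)
  qed simp
  then show ?thesis by (simp add: self_adjoint_def poly_op_bounded[OF TB])
qed

text \<open>
  This reduces bounds on the norm of \<open>p(T)\<close> to bounds on a quadratic form.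
\<close>

lemma poly_op_norm_sq:
  assumes T: "self_adjoint T" and f: "f \<in> vectors \<H>"
  shows "\<parallel>poly_op \<H> p T f\<parallel>\<^sup>2 = \<langle>poly_op \<H> (p\<^sup>2) T f, f\<rangle>"
  using f self_adjoint_ip[OF poly_op_self_adjoint[OF T], of "poly_op \<H> p T f" f p]
    poly_op_closed[OF self_adjoint_bounded[OF T]]
  by (simp add: power2_eq_square[of p] poly_op_mult[OF self_adjoint_bounded[OF T]] vnorm_sq)

section \<open>The spectrum of a self-adjoint operator\<close>

text \<open>
  The set on which the functional calculus requires uniform convergence; only real points of the
  spectrum enter there.
\<close>

definition real_spectrum :: "(('o \<Rightarrow> complex) \<Rightarrow> 'o \<Rightarrow> complex) \<Rightarrow> real set"
  where "real_spectrum T = {t. complex_of_real t \<in> spectrum_op \<H> T}"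

definition bounded_below :: "(('o \<Rightarrow> complex) \<Rightarrow> 'o \<Rightarrow> complex) \<Rightarrow> bool"
  where "bounded_below S \<longleftrightarrow> (\<exists>c>0. \<forall>f\<in>vectors \<H>. c * \<parallel>f\<parallel> \<le> \<parallel>S f\<parallel>)"

text \<open>
  If \<open>S\<close> is a bounded inverse of \<open>T - t\<close>, then \<open>\<parallel>f\<parallel> \<le> \<parallel>S\<parallel> \<parallel>(T - t) f\<parallel>\<close>.
\<close>

lemma bounded_below_outside_spectrum:
  assumes T: "T \<in> bounded_ops \<H>" and t: "t \<notin> real_spectrum T"
  shows "bounded_below (poly_op \<H> [:- t, 1:] T)"
proof -
  from t obtain S where S: "S \<in> bounded_ops \<H>"
    "\<And>f. f \<in> vectors \<H> \<Longrightarrow> S (T f - complex_of_real t \<cdot> f) = f"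
    by (auto simp: real_spectrum_def spectrum_op_def)
  obtain C where C: "0 < C" "\<And>f. f \<in> vectors \<H> \<Longrightarrow> \<parallel>S f\<parallel> \<le> C * \<parallel>f\<parallel>" using op_bound[OF S(1)] by blast
  have "(1 / C) * \<parallel>f\<parallel> \<le> \<parallel>poly_op \<H> [:- t, 1:] T f\<parallel>" if f: "f \<in> vectors \<H>" for f
  proof -
    have "poly_op \<H> [:- t, 1:] T f = T f - complex_of_real t \<cdot> f"
      using f by (simp add: poly_op_linear[OF T] fscale_def fun_eq_iff)
    then show ?thesis
      using C(2)[of "T f - complex_of_real t \<cdot> f"] S(2)[OF f] C(1) op_closed[OF T f] f
      by (simp add: pos_divide_le_eq mult.commute)
  qed
  then show ?thesis unfolding bounded_below_def using C(1) by (intro exI[of _ "1 / C"]) simp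
qed

lemma bounded_below_compose:
  assumes S: "bounded_below S" and T: "bounded_below T" "T \<in> bounded_ops \<H>"
  shows "bounded_below (S \<circ> T)"
proof -
  obtain c where c: "0 < c" "\<And>f. f \<in> vectors \<H> \<Longrightarrow> c * \<parallel>f\<parallel> \<le> \<parallel>S f\<parallel>"
    using S by (auto simp: bounded_below_def)
  obtain d where d: "0 < d" "\<And>f. f \<in> vectors \<H> \<Longrightarrow> d * \<parallel>f\<parallel> \<le> \<parallel>T f\<parallel>"
    using T by (auto simp: bounded_below_def)
  have "c * d * \<parallel>f\<parallel> \<le> \<parallel>S (T f)\<parallel>" if f: "f \<in> vectors \<H>" for f
    using order_trans[OF mult_left_mono[OF d(2)[OF f], of c] c(2)[OF op_closed[OF T(2) f]]] c(1)
    by (simp add: mult.assoc)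
  then show ?thesis unfolding bounded_below_def using c(1) d(1) by (intro exI[of _ "c * d"]) simp
qed

lemma coercive_bounded_below:
  assumes "0 < c" "\<And>f. f \<in> vectors \<H> \<Longrightarrow> c * \<parallel>f\<parallel>\<^sup>2 \<le> \<langle>S f, f\<rangle>" "S \<in> bounded_ops \<H>"
    and f: "f \<in> vectors \<H>"
  shows "c * \<parallel>f\<parallel> \<le> \<parallel>S f\<parallel>"
proof -
  have "c * \<parallel>f\<parallel> * \<parallel>f\<parallel> \<le> \<parallel>S f\<parallel> * \<parallel>f\<parallel>"
    using assms(2)[OF f] re_ip_le[OF op_closed[OF assms(3) f] f] by (simp add: power2_eq_square)
  then show ?thesis
    using f vnorm_nonneg[OF op_closed[OF assms(3) f]] vnorm_nonneg[OF f]
    by (cases "\<parallel>f\<parallel> = 0") (simp_all add: mult_le_cancel_right)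
qed

text \<open>
  This plays the part of the spectral mapping theorem. By induction on the degree, \<open>p(T)\<close> is a product of operators
  that are bounded below: real linear factors have their zero outside the spectrum, and the other
  factors \<open>(x - b)\<^sup>2 + c\<^sup>2\<close> give coercive operators.
\<close>

lemma poly_op_bounded_below:
  assumes T: "self_adjoint T" and "p \<noteq> 0" "\<And>t. t \<in> real_spectrum T \<Longrightarrow> poly p t \<noteq> 0"
  shows "bounded_below (poly_op \<H> p T)"
  using assms(2,3)
proof (induction "degree p" arbitrary: p rule: less_induct)
  case (less p)
  note TB = self_adjoint_bounded[OF T]
  show "bounded_below (poly_op \<H> p T)"
  proof (cases "degree p = 0")
    case True
    then obtain a where p: "p = [:a:]" by (rule degree_eq_zeroE)
    then have "a \<noteq> 0" using less.prems by simp
    then show ?thesis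
      unfolding bounded_below_def p
      by (intro exI[of _ "\<bar>a\<bar>"]) (simp add: poly_op_const[OF TB] vnorm_scale_real)
  next
    case False
    \<comment> \<open>Splitting off a factor that is bounded below leaves a polynomial of smaller degree.\<close>
    have split: "bounded_below (poly_op \<H> p T)"
      if pq: "p = d * q" and d: "0 < degree d" "bounded_below (poly_op \<H> d T)" for d q
    proof -
      have q: "q \<noteq> 0" "d \<noteq> 0" using pq less.prems(1) by auto
      then have "degree q < degree p" using d(1) by (simp add: pq degree_mult_eq)
      moreover have "poly q t \<noteq> 0" if "t \<in> real_spectrum T" for t
        using less.prems(2)[OF that] by (simp add: pq)
      ultimately have "bounded_below (poly_op \<H> q T)" using less.hyps q by blast
      from bounded_below_compose[OF d(2) this poly_op_bounded[OF TB]]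
      show ?thesis by (simp add: bounded_below_def pq poly_op_mult[OF TB])
    qed
    consider t q where "p = [:- t, 1:] * q"
      | b c q where "c \<noteq> 0" "p = [:b\<^sup>2 + c\<^sup>2, - 2 * b, 1:] * q"
      using real_poly_factor[of p] False by blast
    then show ?thesis
    proof cases
      case (1 t q)
      then have "poly p t = 0" by simp
      then have "t \<notin> real_spectrum T" using less.prems(2) by blast
      then show ?thesis using split[OF 1] bounded_below_outside_spectrum[OF TB] by simp
    next
      case (2 b c q)
      let ?d = "[:b\<^sup>2 + c\<^sup>2, - 2 * b, 1:]"
      \<comment> \<open>The quadratic factor is coercive because it is a square plus a positive constant.\<close>
      have d: "?d = [:- b, 1:]\<^sup>2 + [:c\<^sup>2:]" by (simp add: power2_eq_square)
      have "c\<^sup>2 * \<parallel>f\<parallel>\<^sup>2 \<le> \<langle>poly_op \<H> ?d T f, f\<rangle>" if f: "f \<in> vectors \<H>" for f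
      proof -
        have "\<langle>poly_op \<H> ?d T f, f\<rangle> = \<parallel>poly_op \<H> [:- b, 1:] T f\<parallel>\<^sup>2 + c\<^sup>2 * \<parallel>f\<parallel>\<^sup>2"
          unfolding d using f poly_op_closed[OF TB f]
          by (simp add: poly_op_add poly_op_const[OF TB] ip_simps closed vnorm_sq[OF f]
              poly_op_norm_sq[OF T f] del: of_real_power)
        then show ?thesis by simp
      qed
      from coercive_bounded_below[OF _ this poly_op_bounded[OF TB]]
      have "bounded_below (poly_op \<H> ?d T)"
        unfolding bounded_below_def using \<open>c \<noteq> 0\<close> by (intro exI[of _ "c\<^sup>2"]) simp
      then show ?thesis using split[OF 2(2)] by simp
    qed
  qed
qed

text \<open>
  The Cauchy-Schwarz inequality for the positive form \<open>\<langle>S f, g\<rangle>\<close> with \<open>g = S f\<close> yields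
  \<open>\<parallel>S f\<parallel>\<^sup>4 \<le> \<langle>S f, f\<rangle> \<langle>S g, g\<rangle>\<close>, and \<open>\<langle>S g, g\<rangle> \<le> C \<parallel>g\<parallel>\<^sup>2\<close>.
\<close>

lemma positive_operator_norm_bound:
  assumes S: "self_adjoint S" and pos: "\<And>f. f \<in> vectors \<H> \<Longrightarrow> 0 \<le> \<langle>S f, f\<rangle>"
    and C: "\<And>f. f \<in> vectors \<H> \<Longrightarrow> \<parallel>S f\<parallel> \<le> C * \<parallel>f\<parallel>" and f: "f \<in> vectors \<H>"
  shows "\<parallel>S f\<parallel>\<^sup>2 \<le> C * \<langle>S f, f\<rangle>"
proof (cases "S f = 0")
  case True
  then show ?thesis using f by simp
next
  case False
  note SB = self_adjoint_bounded[OF S]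
  let ?g = "S f"
  have g: "?g \<in> vectors \<H>" and Sg: "S ?g \<in> vectors \<H>" using f op_closed[OF SB] by auto
  have "0 \<le> \<langle>S f, f\<rangle> + 2 * t * \<langle>S f, ?g\<rangle> + t\<^sup>2 * \<langle>S ?g, ?g\<rangle>" for t
  proof -
    have "S (f + complex_of_real t \<cdot> ?g) = S f + complex_of_real t \<cdot> S ?g"
      using op_add[OF SB f scale_real_closed[OF g]] op_scale[OF SB real_scalar g] by simp
    moreover have "\<langle>S ?g, f\<rangle> = \<langle>?g, ?g\<rangle>" using self_adjoint_ip[OF S g f] by simp
    ultimately show ?thesis
      using pos[of "f + complex_of_real t \<cdot> ?g"] f g Sg
      by (simp add: ip_simps closed power2_eq_square algebra_simps)
  qed
  then have "(\<parallel>?g\<parallel>\<^sup>2)\<^sup>2 \<le> \<langle>S f, f\<rangle> * \<langle>S ?g, ?g\<rangle>"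
    using discriminant_bound[of "\<langle>S f, f\<rangle>" "\<langle>S f, ?g\<rangle>" "\<langle>S ?g, ?g\<rangle>"] pos[OF g] vnorm_sq[OF g] by simp
  also have "\<langle>S ?g, ?g\<rangle> \<le> C * \<parallel>?g\<parallel> * \<parallel>?g\<parallel>"
    using re_ip_le[OF Sg g] C[OF g] mult_right_mono[of "\<parallel>S ?g\<parallel>" "C * \<parallel>?g\<parallel>" "\<parallel>?g\<parallel>"] g by simp
  then have "\<langle>S f, f\<rangle> * \<langle>S ?g, ?g\<rangle> \<le> \<langle>S f, f\<rangle> * (C * \<parallel>?g\<parallel>\<^sup>2)"
    using pos[OF f] by (simp add: mult_left_mono power2_eq_square)
  finally have "\<parallel>?g\<parallel>\<^sup>2 * \<parallel>?g\<parallel>\<^sup>2 \<le> (C * \<langle>S f, f\<rangle>) * \<parallel>?g\<parallel>\<^sup>2"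
    by (simp add: power2_eq_square mult_ac)
  moreover have "0 < \<parallel>?g\<parallel>\<^sup>2" using vnorm_pos[OF g False] by simp
  ultimately show ?thesis by (rule mult_right_le_imp_le)
qed

text \<open>
  Let \<open>m\<close> be the greatest lower bound of the quadratic form and \<open>Q = S - m\<close>. Then \<open>Q\<close> is positive, so
  \<open>\<parallel>Q f\<parallel>\<^sup>2 \<le> D \<langle>Q f, f\<rangle>\<close> for some \<open>D\<close>. If \<open>Q\<close> were bounded below, then the form of \<open>Q\<close> would exceed a
  positive multiple of \<open>\<parallel>f\<parallel>\<^sup>2\<close> and \<open>m\<close> would not be the greatest lower bound.
\<close>

lemma greatest_lower_bound_not_bounded_below:
  assumes S: "self_adjoint S" and x: "x \<in> vectors \<H>" "x \<noteq> 0"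
  obtains m where "\<And>f. f \<in> vectors \<H> \<Longrightarrow> m * \<parallel>f\<parallel>\<^sup>2 \<le> \<langle>S f, f\<rangle>"
    "\<not> bounded_below (\<lambda>f. S f - complex_of_real m \<cdot> f)"
proof -
  note SB = self_adjoint_bounded[OF S]
  note Scl = op_closed[OF SB]
  obtain C where C: "0 < C" "\<And>f. f \<in> vectors \<H> \<Longrightarrow> \<parallel>S f\<parallel> \<le> C * \<parallel>f\<parallel>" using op_bound[OF SB] by blast
  \<comment> \<open>The set of all lower bounds; its supremum is the required number.\<close>
  define L where "L = {m. \<forall>f\<in>vectors \<H>. m * \<parallel>f\<parallel>\<^sup>2 \<le> \<langle>S f, f\<rangle>}"
  have "- C \<in> L"
  proof -
    have "- (\<parallel>S f\<parallel> * \<parallel>f\<parallel>) \<le> \<langle>S f, f\<rangle>" if "f \<in> vectors \<H>" for f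
      using cauchy_schwarz[OF Scl that, OF that] abs_Re_le_cmod[of "ip \<H> (S f) f"] that by linarith
    moreover have "\<parallel>S f\<parallel> * \<parallel>f\<parallel> \<le> C * \<parallel>f\<parallel>\<^sup>2" if "f \<in> vectors \<H>" for f
      using mult_right_mono[OF C(2)[OF that], of "\<parallel>f\<parallel>"] that by (simp add: power2_eq_square)
    ultimately show ?thesis unfolding L_def by force
  qed
  have upper: "m \<le> \<langle>S f, f\<rangle> / \<parallel>f\<parallel>\<^sup>2" if "m \<in> L" "f \<in> vectors \<H>" "f \<noteq> 0" for m f
    using that vnorm_pos[of f] by (simp add: L_def pos_le_divide_eq)
  then have bdd: "bdd_above L" using x by (intro bdd_aboveI) blast
  define m where "m = Sup L"
  have m: "m * \<parallel>f\<parallel>\<^sup>2 \<le> \<langle>S f, f\<rangle>" if f: "f \<in> vectors \<H>" for f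
  proof (cases "f = 0")
    case False
    then have "m \<le> \<langle>S f, f\<rangle> / \<parallel>f\<parallel>\<^sup>2"
      unfolding m_def using \<open>- C \<in> L\<close> upper f by (intro cSup_least) auto
    then show ?thesis using vnorm_pos[OF f False] by (simp add: pos_le_divide_eq)
  qed (use f op_closed[OF SB] in simp)
  define Q where "Q = (\<lambda>f. complex_of_real 1 \<cdot> S f + complex_of_real (- m) \<cdot> id_op f)"
  have Q: "Q f = S f - complex_of_real m \<cdot> f" if "f \<in> vectors \<H>" for f
    using that by (simp add: Q_def fscale_def fun_eq_iff)
  have QB: "Q \<in> bounded_ops \<H>"
    unfolding Q_def by (rule op_linear_combination[OF SB id_op_bounded])
  have Q_sa: "self_adjoint Q"
    using self_adjoint_ip[OF S] Scl unfolding self_adjoint_def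
    by (simp add: QB Q ip_simps)
  have Q_ip: "\<langle>Q f, f\<rangle> = \<langle>S f, f\<rangle> - m * \<parallel>f\<parallel>\<^sup>2" if "f \<in> vectors \<H>" for f
    using that Scl by (simp add: Q ip_simps vnorm_sq)
  have "\<not> bounded_below (\<lambda>f. S f - complex_of_real m \<cdot> f)"
  proof
    assume "bounded_below (\<lambda>f. S f - complex_of_real m \<cdot> f)"
    then obtain c where c: "0 < c" "\<And>f. f \<in> vectors \<H> \<Longrightarrow> c * \<parallel>f\<parallel> \<le> \<parallel>Q f\<parallel>"
      by (auto simp: bounded_below_def Q)
    obtain D where D: "0 < D" "\<And>f. f \<in> vectors \<H> \<Longrightarrow> \<parallel>Q f\<parallel> \<le> D * \<parallel>f\<parallel>" using op_bound[OF QB] by blast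
    \<comment> \<open>A lower bound \<open>c\<close> for the norm of \<open>Q\<close> would allow \<open>m\<close> to be increased.\<close>
    have "(m + c\<^sup>2 / D) * \<parallel>f\<parallel>\<^sup>2 \<le> \<langle>S f, f\<rangle>" if f: "f \<in> vectors \<H>" for f
    proof -
      have "c\<^sup>2 * \<parallel>f\<parallel>\<^sup>2 \<le> \<parallel>Q f\<parallel>\<^sup>2"
        using c f power_mono[OF c(2)[OF f], of 2] by (simp add: power_mult_distrib)
      also have "\<dots> \<le> D * \<langle>Q f, f\<rangle>"
        by (rule positive_operator_norm_bound[OF Q_sa _ D(2) f]) (simp_all add: Q_ip m)
      finally have "c\<^sup>2 / D * \<parallel>f\<parallel>\<^sup>2 \<le> \<langle>Q f, f\<rangle>"
        using D(1) by (simp add: pos_divide_le_eq mult.commute)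
      then show ?thesis using Q_ip[OF f] by (simp add: distrib_right)
    qed
    then have "m + c\<^sup>2 / D \<in> L" by (simp add: L_def)
    then have "m + c\<^sup>2 / D \<le> m" unfolding m_def by (rule cSup_upper[OF _ bdd])
    then show False using c(1) D(1) by (simp add: divide_le_0_iff)
  qed
  with m show ?thesis by (rule that)
qed

text \<open>
  With \<open>m\<close> the greatest lower bound of the quadratic form of \<open>p(T)\<close>, the operator \<open>p(T) - m\<close> is not
  bounded below, so \<open>p - m\<close> is zero or has a zero on the spectrum.
  In particular the spectrum is not empty, and the constant case follows as well.
\<close>

theorem poly_op_minimum_in_spectrum:
  assumes T: "self_adjoint T" and x: "x \<in> vectors \<H>" "x \<noteq> 0"
  shows "\<exists>t\<in>real_spectrum T. \<forall>f\<in>vectors \<H>. poly p t * \<parallel>f\<parallel>\<^sup>2 \<le> \<langle>poly_op \<H> p T f, f\<rangle>"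
proof -
  note TB = self_adjoint_bounded[OF T]
  have main: "\<exists>m. (\<forall>f\<in>vectors \<H>. m * \<parallel>f\<parallel>\<^sup>2 \<le> \<langle>poly_op \<H> q T f, f\<rangle>)
      \<and> (q - [:m:] = 0 \<or> (\<exists>t\<in>real_spectrum T. poly q t = m))" for q
  proof -
    obtain m where m: "\<And>f. f \<in> vectors \<H> \<Longrightarrow> m * \<parallel>f\<parallel>\<^sup>2 \<le> \<langle>poly_op \<H> q T f, f\<rangle>"
      and nb: "\<not> bounded_below (\<lambda>f. poly_op \<H> q T f - complex_of_real m \<cdot> f)"
      using greatest_lower_bound_not_bounded_below[OF poly_op_self_adjoint[OF T] x] by blast
    have "\<not> bounded_below (poly_op \<H> (q - [:m:]) T)"
      using nb by (simp add: bounded_below_def poly_op_diff poly_op_const[OF TB])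
    then have "q - [:m:] = 0 \<or> (\<exists>t\<in>real_spectrum T. poly (q - [:m:]) t = 0)"
      using poly_op_bounded_below[OF T] by blast
    then show ?thesis using m by auto
  qed
  \<comment> \<open>The coordinate polynomial differs from every constant and so yields a point of the spectrum.\<close>
  have "real_spectrum T \<noteq> {}"
    using main[of "[:0, 1:]"] by auto
  with main[of p] show ?thesis by fastforce
qed

lemma poly_op_mono_on_spectrum:
  assumes T: "self_adjoint T" and f: "f \<in> vectors \<H>"
    and "\<And>t. t \<in> real_spectrum T \<Longrightarrow> poly p t \<le> poly q t"
  shows "\<langle>poly_op \<H> p T f, f\<rangle> \<le> \<langle>poly_op \<H> q T f, f\<rangle>"
proof (cases "f = 0")
  case True
  then show ?thesis using poly_op_closed[OF self_adjoint_bounded[OF T]] f by simp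
next
  case False
  obtain t where t: "t \<in> real_spectrum T"
    "poly (q - p) t * \<parallel>f\<parallel>\<^sup>2 \<le> \<langle>poly_op \<H> (q - p) T f, f\<rangle>"
    using poly_op_minimum_in_spectrum[OF T f False] f by blast
  have "0 \<le> poly (q - p) t * \<parallel>f\<parallel>\<^sup>2" using assms(3)[OF t(1)] by simp
  then show ?thesis
    using t(2) f poly_op_closed[OF self_adjoint_bounded[OF T] f]
    by (simp add: poly_op_diff ip_diff_left)
qed

lemma poly_op_norm_le:
  assumes T: "self_adjoint T" and f: "f \<in> vectors \<H>"
    and M: "0 \<le> M" "\<And>t. t \<in> real_spectrum T \<Longrightarrow> \<bar>poly p t\<bar> \<le> M"
  shows "\<parallel>poly_op \<H> p T f\<parallel> \<le> M * \<parallel>f\<parallel>"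
proof (rule power2_le_imp_le)
  have "\<parallel>poly_op \<H> p T f\<parallel>\<^sup>2 = \<langle>poly_op \<H> (p\<^sup>2) T f, f\<rangle>" by (rule poly_op_norm_sq[OF T f])
  also have "\<dots> \<le> \<langle>poly_op \<H> [:M\<^sup>2:] T f, f\<rangle>"
    using M by (intro poly_op_mono_on_spectrum[OF T f]) (simp add: abs_le_square_iff[symmetric])
  also have "\<dots> = (M * \<parallel>f\<parallel>)\<^sup>2"
    using f by (simp add: poly_op_const[OF self_adjoint_bounded[OF T]] ip_scale vnorm_sq
        power_mult_distrib del: of_real_power)
  finally show "\<parallel>poly_op \<H> p T f\<parallel>\<^sup>2 \<le> (M * \<parallel>f\<parallel>)\<^sup>2" .
qed (use M f in simp)

text \<open>
  Coercivity makes \<open>S\<close> bounded below, hence injective with a bounded inverse on its range, and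
  the representation of the functionals \<open>f \<mapsto> ip \<H> f y\<close> shows that it is onto.
\<close>

lemma coercive_inverse:
  assumes S: "self_adjoint S" and c: "0 < c" "\<And>f. f \<in> vectors \<H> \<Longrightarrow> c * \<parallel>f\<parallel>\<^sup>2 \<le> \<langle>S f, f\<rangle>"
  shows "\<exists>R\<in>bounded_ops \<H>. \<forall>f\<in>vectors \<H>. R (S f) = f \<and> S (R f) = f"
proof -
  note SB = self_adjoint_bounded[OF S]
  note Scl = op_closed[OF SB]
  note below = coercive_bounded_below[OF c SB]
  have inj: "f = g" if fg: "f \<in> vectors \<H>" "g \<in> vectors \<H>" "S f = S g" for f g
  proof -
    have "c * \<parallel>f - g\<parallel> \<le> 0" using below[of "f - g"] fg by (simp add: op_diff[OF SB])
    then have "\<parallel>f - g\<parallel> \<le> 0" using c(1) by (simp add: mult_le_0_iff)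
    then have "\<parallel>f - g\<parallel> = 0" using vnorm_nonneg[OF diff_closed[OF fg(1,2)]] by (rule antisym)
    then show ?thesis using fg vnorm_eq_0[of "f - g"] by simp
  qed
  have "\<exists>g\<in>vectors \<H>. S g = y" if y: "y \<in> vectors \<H>" for y
  proof -
    have "\<exists>g\<in>vectors \<H>. \<forall>f\<in>vectors \<H>. ip \<H> f y = ip \<H> f (S g)"
      by (rule coercive_representation[OF S c, of "\<lambda>f. ip \<H> f y" "\<parallel>y\<parallel>"])
        (use y cauchy_schwarz[OF _ y] in \<open>simp_all add: ip_simps ip_scalar mult.commute\<close>)
    then obtain g where g: "g \<in> vectors \<H>" "\<forall>f\<in>vectors \<H>. ip \<H> f y = ip \<H> f (S g)" by blast
    have "S g = y" by (rule eq_of_ip_eq_right[OF Scl[OF g(1)] y]) (use g(2) in simp)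
    then show ?thesis using g(1) by blast
  qed
  then obtain r where r: "\<And>y. y \<in> vectors \<H> \<Longrightarrow> r y \<in> vectors \<H>"
    "\<And>y. y \<in> vectors \<H> \<Longrightarrow> S (r y) = y" by metis
  define R where "R y = (if y \<in> vectors \<H> then r y else 0)" for y
  have R: "R y \<in> vectors \<H>" "S (R y) = y" if "y \<in> vectors \<H>" for y
    using r that by (simp_all add: R_def)
  have "R \<in> bounded_ops \<H>"
  proof (rule bounded_opsI[of _ "1 / c"])
    fix f g assume "f \<in> vectors \<H>" "g \<in> vectors \<H>"
    then show "R (f + g) = R f + R g"
      using op_add[OF SB, of "R f" "R g"] R by - (rule inj, simp_all add: closed)
  next
    fix a f assume "a \<in> scalars \<H>" "f \<in> vectors \<H>"
    then show "R (a \<cdot> f) = a \<cdot> R f"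
      using op_scale[OF SB, of a "R f"] R by - (rule inj, simp_all add: closed)
  next
    fix f assume f: "f \<in> vectors \<H>"
    then show "\<parallel>R f\<parallel> \<le> 1 / c * \<parallel>f\<parallel>"
      using below[of "R f"] R[OF f] c(1) by (simp add: pos_le_divide_eq mult.commute)
  qed (use R in \<open>simp_all add: R_def\<close>)
  moreover have "R (S f) = f" if f: "f \<in> vectors \<H>" for f
    using f R Scl by - (rule inj, simp_all)
  ultimately show ?thesis using R by blast
qed

text \<open>
  For \<open>t\<close> outside the interval either \<open>T - t\<close> or \<open>t - T\<close> is coercive, hence invertible.
\<close>

lemma spectrum_in_interval:
  assumes T: "self_adjoint T"
    and lower: "\<And>f. f \<in> vectors \<H> \<Longrightarrow> a * \<parallel>f\<parallel>\<^sup>2 \<le> \<langle>T f, f\<rangle>"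
    and upper: "\<And>f. f \<in> vectors \<H> \<Longrightarrow> \<langle>T f, f\<rangle> \<le> b * \<parallel>f\<parallel>\<^sup>2"
  shows "real_spectrum T \<subseteq> {a..b}"
proof -
  note TB = self_adjoint_bounded[OF T]
  have outside: "t \<notin> real_spectrum T"
    if s: "s\<^sup>2 = 1" and c: "0 < c" "\<And>f. f \<in> vectors \<H> \<Longrightarrow> c * \<parallel>f\<parallel>\<^sup>2 \<le> s * (\<langle>T f, f\<rangle> - t * \<parallel>f\<parallel>\<^sup>2)"
    for s c t
  proof -
    \<comment> \<open>The sign \<open>s\<close> makes \<open>s (T - t)\<close> coercive: \<open>s = 1\<close> for \<open>t < a\<close> and \<open>s = - 1\<close> for \<open>b < t\<close>.\<close>
    let ?S = "poly_op \<H> [:- s * t, s:] T"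
    have S: "?S f = complex_of_real s \<cdot> (T f - complex_of_real t \<cdot> f)" if "f \<in> vectors \<H>" for f
      using that by (simp add: poly_op_linear[OF TB] fscale_def fun_eq_iff algebra_simps)
    have "c * \<parallel>f\<parallel>\<^sup>2 \<le> \<langle>?S f, f\<rangle>" if f: "f \<in> vectors \<H>" for f
      unfolding S[OF f] using c(2)[OF f] f op_closed[OF TB f] by (simp add: ip_simps vnorm_sq)
    from coercive_inverse[OF poly_op_self_adjoint[OF T] c(1) this]
    obtain R where R: "R \<in> bounded_ops \<H>"
      "\<And>f. f \<in> vectors \<H> \<Longrightarrow> R (?S f) = f" "\<And>f. f \<in> vectors \<H> \<Longrightarrow> ?S (R f) = f" by blast
    \<comment> \<open>As \<open>s\<^sup>2 = 1\<close>, the inverse of \<open>T - t\<close> is \<open>s R\<close>.\<close>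
    define R' where "R' f = complex_of_real s \<cdot> R f + complex_of_real 0 \<cdot> R f" for f
    have R'B: "R' \<in> bounded_ops \<H>"
      using op_linear_combination[OF R(1) R(1), of s 0] unfolding R'_def .
    have R': "R' f = complex_of_real s \<cdot> R f" for f
      by (simp add: R'_def fscale_simps)
    have "R' (T f - complex_of_real t \<cdot> f) = f \<and> T (R' f) - complex_of_real t \<cdot> R' f = f"
      if f: "f \<in> vectors \<H>" for f
    proof
      have "R (?S f) = complex_of_real s \<cdot> R (T f - complex_of_real t \<cdot> f)"
        unfolding S[OF f] using f op_closed[OF TB f] by (intro op_scale[OF R(1) real_scalar]) simp
      then show "R' (T f - complex_of_real t \<cdot> f) = f"
        using R(2)[OF f] by (simp add: R')
      have Rf: "R f \<in> vectors \<H>" by (rule op_closed[OF R(1) f])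
      have "T (R' f) = complex_of_real s \<cdot> T (R f)"
        using op_scale[OF TB real_scalar Rf, of s] by (simp add: R')
      then have "T (R' f) - complex_of_real t \<cdot> R' f = ?S (R f)"
        unfolding S[OF Rf] R' by (simp add: fscale_simps mult.commute)
      then show "T (R' f) - complex_of_real t \<cdot> R' f = f" using R(3)[OF f] by simp
    qed
    with R'B show ?thesis by (auto simp: real_spectrum_def spectrum_op_def)
  qed
  show ?thesis
  proof
    fix t assume t: "t \<in> real_spectrum T"
    have "\<not> t < a" using outside[of 1 "a - t" t] t lower by (auto simp: left_diff_distrib)
    moreover have "\<not> b < t" using outside[of "-1" "t - b" t] t upper by (auto simp: left_diff_distrib)
    ultimately show "t \<in> {a..b}" by simp
  qed
qed

section \<open>The continuous functional calculus\<close>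

text \<open>
  The norm bound on polynomials in \<open>T\<close> makes \<open>q\<^sub>n(T) f\<close> a Cauchy sequence. Its limit \<open>B f\<close> satisfies an
  estimate that involves \<open>\<phi>\<close> but not the sequence \<open>q\<close>, so every sequence of polynomials
  that tends to \<open>\<phi>\<close> uniformly on the spectrum leads to the same operator.
\<close>

lemma calculus_limit:
  assumes T: "self_adjoint T"
    and q: "uniform_limit (real_spectrum T) (\<lambda>n. poly (q n)) \<phi> sequentially"
  obtains B where "B \<in> bounded_ops \<H>"
    "\<And>p M f. 0 \<le> M \<Longrightarrow> (\<And>t. t \<in> real_spectrum T \<Longrightarrow> \<bar>poly p t - \<phi> t\<bar> \<le> M) \<Longrightarrow>
      f \<in> vectors \<H> \<Longrightarrow> \<parallel>poly_op \<H> p T f - B f\<parallel> \<le> M * \<parallel>f\<parallel>"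
proof -
  note TB = self_adjoint_bounded[OF T]
  note pB = poly_op_bounded[OF TB]
  let ?q = "\<lambda>n. poly_op \<H> (q n) T"
  have near: "\<exists>N. \<forall>n\<ge>N. \<forall>t\<in>real_spectrum T. \<bar>poly (q n) t - \<phi> t\<bar> < e" if "0 < e" for e
    using uniform_limitD[OF q that] by (auto simp: eventually_sequentially dist_real_def)
  have dist: "\<parallel>poly_op \<H> p T f - poly_op \<H> p' T f\<parallel> \<le> (M + e) * \<parallel>f\<parallel>"
    if f: "f \<in> vectors \<H>" and "0 \<le> M" "0 \<le> e"
      and p: "\<And>t. t \<in> real_spectrum T \<Longrightarrow> \<bar>poly p t - \<phi> t\<bar> \<le> M"
      and p': "\<And>t. t \<in> real_spectrum T \<Longrightarrow> \<bar>poly p' t - \<phi> t\<bar> \<le> e" for f p p' M e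
  proof -
    have "\<bar>poly (p - p') t\<bar> \<le> M + e" if "t \<in> real_spectrum T" for t
      using p[OF that] p'[OF that] by simp
    then have "\<parallel>poly_op \<H> (p - p') T f\<parallel> \<le> (M + e) * \<parallel>f\<parallel>"
      using that by (intro poly_op_norm_le[OF T f]) auto
    then show ?thesis by (simp add: poly_op_diff f)
  qed
  have "\<exists>b\<in>vectors \<H>. (\<lambda>n. \<parallel>?q n f - b\<parallel>) \<longlonglongrightarrow> 0" if f: "f \<in> vectors \<H>" for f
  proof (rule complete)
    show "?q n f \<in> vectors \<H>" for n using op_closed[OF pB f] .
    fix e :: real assume e: "0 < e"
    define d where "d = e / (2 * (\<parallel>f\<parallel> + 1))"
    have d: "0 < d" "(d + d) * \<parallel>f\<parallel> < e"
      using e vnorm_nonneg[OF f] by (auto simp: d_def divide_less_eq)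
    obtain N where N: "\<And>n t. n \<ge> N \<Longrightarrow> t \<in> real_spectrum T \<Longrightarrow> \<bar>poly (q n) t - \<phi> t\<bar> < d"
      using near[OF d(1)] by blast
    have "\<parallel>?q m f - ?q n f\<parallel> < e" if "m \<ge> N" "n \<ge> N" for m n
      using dist[OF f, of d d "q m" "q n"] N[OF that(1)] N[OF that(2)] d by (force simp: less_imp_le)
    then show "\<exists>N. \<forall>m\<ge>N. \<forall>n\<ge>N. \<parallel>?q m f - ?q n f\<parallel> < e" by blast
  qed
  then obtain b where b: "\<And>f. f \<in> vectors \<H> \<Longrightarrow> b f \<in> vectors \<H>"
    "\<And>f. f \<in> vectors \<H> \<Longrightarrow> (\<lambda>n. \<parallel>?q n f - b f\<parallel>) \<longlonglongrightarrow> 0" by metis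
  define B where "B f = (if f \<in> vectors \<H> then b f else 0)" for f
  have B: "B f \<in> vectors \<H>" "(\<lambda>n. \<parallel>?q n f - B f\<parallel>) \<longlonglongrightarrow> 0" if "f \<in> vectors \<H>" for f
    using that b by (simp_all add: B_def)
  have est: "\<parallel>poly_op \<H> p T f - B f\<parallel> \<le> M * \<parallel>f\<parallel>"
    if M: "0 \<le> M" "\<And>t. t \<in> real_spectrum T \<Longrightarrow> \<bar>poly p t - \<phi> t\<bar> \<le> M" and f: "f \<in> vectors \<H>"
    for p M f
  proof (rule field_le_epsilon)
    fix e :: real assume e: "0 < e"
    define d where "d = e / (2 * (\<parallel>f\<parallel> + 1))"
    have d: "0 < d" "d * \<parallel>f\<parallel> < e / 2"
      using e vnorm_nonneg[OF f] by (auto simp: d_def divide_less_eq)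
    obtain N where N: "\<And>n t. n \<ge> N \<Longrightarrow> t \<in> real_spectrum T \<Longrightarrow> \<bar>poly (q n) t - \<phi> t\<bar> < d"
      using near[OF d(1)] by blast
    have "\<forall>\<^sub>F n in sequentially. \<parallel>?q n f - B f\<parallel> < e / 2"
      using order_tendstoD(2)[OF B(2)[OF f], of "e / 2"] e by simp
    then obtain n where n: "n \<ge> N" "\<parallel>?q n f - B f\<parallel> < e / 2"
      unfolding eventually_sequentially by (metis nle_le)
    have "\<parallel>poly_op \<H> p T f - B f\<parallel> \<le> \<parallel>poly_op \<H> p T f - ?q n f\<parallel> + \<parallel>?q n f - B f\<parallel>"
      using f op_closed[OF pB f] B(1) by (intro vnorm_diff_triangle) auto
    also have "\<dots> \<le> (M + d) * \<parallel>f\<parallel> + e / 2"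
      using n(2) dist[OF f M(1) less_imp_le[OF d(1)] M(2) less_imp_le[OF N[OF n(1)]]] by simp
    also have "\<dots> \<le> M * \<parallel>f\<parallel> + e" using d(2) by (simp add: distrib_right)
    finally show "\<parallel>poly_op \<H> p T f - B f\<parallel> \<le> M * \<parallel>f\<parallel> + e" .
  qed
  obtain N where N: "\<And>t. t \<in> real_spectrum T \<Longrightarrow> \<bar>poly (q N) t - \<phi> t\<bar> < 1"
    using near[of 1] by auto
  obtain C where C: "0 < C" "\<And>f. f \<in> vectors \<H> \<Longrightarrow> \<parallel>?q N f\<parallel> \<le> C * \<parallel>f\<parallel>"
    using op_bound[OF pB] by blast
  have "B \<in> bounded_ops \<H>"
  proof (rule bounded_opsI[of _ "C + 1"])
    fix f g assume fg: "f \<in> vectors \<H>" "g \<in> vectors \<H>"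
    show "B (f + g) = B f + B g"
    proof (rule vlim_unique)
      show "(\<lambda>n. \<parallel>?q n (f + g) - (B f + B g)\<parallel>) \<longlonglongrightarrow> 0"
        using vlim_add[OF op_closed[OF pB fg(1)] B(1)[OF fg(1)] op_closed[OF pB fg(2)] B(1)[OF fg(2)]
            B(2)[OF fg(1)] B(2)[OF fg(2)]] op_add[OF pB fg] by simp
    qed (use fg B add_closed[OF fg] op_closed[OF pB add_closed[OF fg]] in \<open>auto intro: add_closed\<close>)
  next
    fix c f assume c: "c \<in> scalars \<H>" and f: "f \<in> vectors \<H>"
    show "B (c \<cdot> f) = c \<cdot> B f"
    proof (rule vlim_unique)
      show "(\<lambda>n. \<parallel>?q n (c \<cdot> f) - c \<cdot> B f\<parallel>) \<longlonglongrightarrow> 0"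
        using vlim_scale[OF op_closed[OF pB f] B(1)[OF f] c B(2)[OF f]] op_scale[OF pB c f] by simp
    qed (use c f B scale_closed[OF c f] op_closed[OF pB scale_closed[OF c f]]
          in \<open>auto intro: scale_closed\<close>)
  next
    fix f assume f: "f \<in> vectors \<H>"
    have "\<parallel>?q N f - B f\<parallel> \<le> 1 * \<parallel>f\<parallel>" using N f by (intro est) (auto simp: less_imp_le)
    then show "\<parallel>B f\<parallel> \<le> (C + 1) * \<parallel>f\<parallel>"
      using abs_vnorm_diff[OF op_closed[OF pB f, of "q N"] B(1)[OF f]] C(2)[OF f]
      by (simp add: distrib_right)
  qed (use B in \<open>simp_all add: B_def\<close>)
  then show ?thesis using est by (rule that)
qed

text \<open>
  This justifies the definite description in the definition of the calculus: the limit operator has the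
  required property, and an operator with that property is a pointwise limit of \<open>q\<^sub>n(T)\<close>, hence
  unique.
\<close>

theorem cont_calc:
  assumes T: "self_adjoint T"
    and q: "uniform_limit (real_spectrum T) (\<lambda>n. poly (q n)) \<phi> sequentially"
  shows "cont_calc \<H> \<phi> T \<in> bounded_ops \<H>"
    and "f \<in> vectors \<H> \<Longrightarrow> (\<lambda>n. \<parallel>poly_op \<H> (q n) T f - cont_calc \<H> \<phi> T f\<parallel>) \<longlonglongrightarrow> 0"
proof -
  note pB = poly_op_bounded[OF self_adjoint_bounded[OF T]]
  let ?P = "\<lambda>B. B \<in> bounded_ops \<H> \<and> (\<forall>p :: nat \<Rightarrow> real poly.
      uniform_limit (real_spectrum T) (\<lambda>n. poly (p n)) \<phi> sequentially \<longrightarrow>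
      (\<lambda>n. op_norm \<H> (poly_op \<H> (p n) T - B)) \<longlonglongrightarrow> 0)"
  obtain B where B: "B \<in> bounded_ops \<H>"
    "\<And>p M f. 0 \<le> M \<Longrightarrow> (\<And>t. t \<in> real_spectrum T \<Longrightarrow> \<bar>poly p t - \<phi> t\<bar> \<le> M) \<Longrightarrow>
      f \<in> vectors \<H> \<Longrightarrow> \<parallel>poly_op \<H> p T f - B f\<parallel> \<le> M * \<parallel>f\<parallel>"
    using calculus_limit[OF T q] by blast
  have "(\<lambda>n. op_norm \<H> (poly_op \<H> (p n) T - B)) \<longlonglongrightarrow> 0"
    if p: "uniform_limit (real_spectrum T) (\<lambda>n. poly (p n)) \<phi> sequentially" for p
  proof (rule tendstoI)
    fix e :: real assume e: "0 < e"
    have "op_norm \<H> (poly_op \<H> (p n) T - B) < e"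
      if "\<forall>t\<in>real_spectrum T. dist (poly (p n) t) (\<phi> t) < e / 2" for n
    proof -
      have "op_norm \<H> (poly_op \<H> (p n) T - B) \<le> e / 2"
        using that e B(2)[of "e / 2" "p n"]
        by (intro op_norm_least) (auto simp: dist_real_def less_imp_le)
      then show ?thesis using e by simp
    qed
    then have "dist (op_norm \<H> (poly_op \<H> (p n) T - B)) 0 < e"
      if "\<forall>t\<in>real_spectrum T. dist (poly (p n) t) (\<phi> t) < e / 2" for n
      using that op_norm_nonneg[OF op_minus[OF pB B(1)], of "p n"] by simp
    then show "\<forall>\<^sub>F n in sequentially. dist (op_norm \<H> (poly_op \<H> (p n) T - B)) 0 < e"
      using eventually_mono[OF uniform_limitD[OF p, of "e / 2"]] e by simp
  qed
  then have ex: "?P B" using B(1) by blast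
  have lim: "(\<lambda>n. \<parallel>poly_op \<H> (q n) T f - D f\<parallel>) \<longlonglongrightarrow> 0" if D: "?P D" and f: "f \<in> vectors \<H>" for D f
  proof (rule tendsto_sandwich[OF _ _ tendsto_const])
    have D': "D \<in> bounded_ops \<H>" "(\<lambda>n. op_norm \<H> (poly_op \<H> (q n) T - D)) \<longlonglongrightarrow> 0"
      using D q by blast+
    show "(\<lambda>n. op_norm \<H> (poly_op \<H> (q n) T - D) * \<parallel>f\<parallel>) \<longlonglongrightarrow> 0"
      using tendsto_mult_right[OF D'(2), of "\<parallel>f\<parallel>"] by simp
    show "\<forall>\<^sub>F n in sequentially.
        \<parallel>poly_op \<H> (q n) T f - D f\<parallel> \<le> op_norm \<H> (poly_op \<H> (q n) T - D) * \<parallel>f\<parallel>"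
      using op_norm_upper[OF op_minus[OF pB D'(1)] f] by simp
    show "\<forall>\<^sub>F n in sequentially. 0 \<le> \<parallel>poly_op \<H> (q n) T f - D f\<parallel>"
      using op_closed[OF pB f] op_closed[OF D'(1) f] by simp
  qed
  have "D = D'" if D: "?P D" and D': "?P D'" for D D'
  proof
    fix f show "D f = D' f"
    proof (cases "f \<in> vectors \<H>")
      case True
      show ?thesis
        by (rule vlim_unique[OF op_closed[OF pB True] _ _ lim[OF D True] lim[OF D' True]])
          (use D D' True op_closed in blast)+
    next
      case False
      then show ?thesis using D D' op_outside[of D f] op_outside[of D' f] by simp
    qed
  qed
  with ex have "\<exists>!B. ?P B" by blast
  from theI'[OF this] have P: "?P (cont_calc \<H> \<phi> T)"
    unfolding cont_calc_def real_spectrum_def .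
  then show "cont_calc \<H> \<phi> T \<in> bounded_ops \<H>" by blast
  show "(\<lambda>n. \<parallel>poly_op \<H> (q n) T f - cont_calc \<H> \<phi> T f\<parallel>) \<longlonglongrightarrow> 0" if "f \<in> vectors \<H>"
    by (rule lim[OF P that])
qed

context
  fixes T :: "('o \<Rightarrow> complex) \<Rightarrow> 'o \<Rightarrow> complex" and q :: "nat \<Rightarrow> real poly" and \<phi> :: "real \<Rightarrow> real"
  assumes T: "self_adjoint T"
    and q: "uniform_limit (real_spectrum T) (\<lambda>n. poly (q n)) \<phi> sequentially"
begin

lemma cont_calc_ip_limit:
  assumes "f \<in> vectors \<H>" "g \<in> vectors \<H>"
  shows "(\<lambda>n. ip \<H> (poly_op \<H> (q n) T f) g) \<longlonglongrightarrow> ip \<H> (cont_calc \<H> \<phi> T f) g"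
  using assms poly_op_closed[OF self_adjoint_bounded[OF T]] op_closed[OF cont_calc(1)[OF T q]]
  by (intro tendsto_ip cont_calc(2)[OF T q]) auto

lemma cont_calc_self_adjoint: "self_adjoint (cont_calc \<H> \<phi> T)"
  unfolding self_adjoint_def
proof (intro conjI ballI)
  show B: "cont_calc \<H> \<phi> T \<in> bounded_ops \<H>" by (rule cont_calc(1)[OF T q])
  fix f g assume f: "f \<in> vectors \<H>" and g: "g \<in> vectors \<H>"
  note cl = poly_op_closed[OF self_adjoint_bounded[OF T]]
  have "(\<lambda>n. cnj (ip \<H> (poly_op \<H> (q n) T g) f)) \<longlonglongrightarrow> cnj (ip \<H> (cont_calc \<H> \<phi> T g) f)"
    by (intro tendsto_cnj cont_calc_ip_limit f g)
  moreover have "cnj (ip \<H> (poly_op \<H> (q n) T g) f) = ip \<H> (poly_op \<H> (q n) T f) g" for n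
    using self_adjoint_ip[OF poly_op_self_adjoint[OF T] f g] ip_commute[OF cl[OF g] f] by simp
  ultimately have "ip \<H> (cont_calc \<H> \<phi> T f) g = cnj (ip \<H> (cont_calc \<H> \<phi> T g) f)"
    using LIMSEQ_unique[OF cont_calc_ip_limit[OF f g]] by simp
  then show "ip \<H> (cont_calc \<H> \<phi> T f) g = ip \<H> f (cont_calc \<H> \<phi> T g)"
    using ip_commute[OF op_closed[OF B g] f] by simp
qed

text \<open>
  If \<open>q\<^sub>n\<close> is within \<open>d\<close> of \<open>\<phi>\<close> on the spectrum, then \<open>p \<le> q\<^sub>n + d\<close> there, and polynomials in \<open>T\<close>
  are monotone. The error \<open>d \<parallel>f\<parallel>\<^sup>2\<close> is arbitrarily small.
\<close>

lemma cont_calc_mono: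
  assumes p: "\<And>t. t \<in> real_spectrum T \<Longrightarrow> poly p t \<le> \<phi> t" and f: "f \<in> vectors \<H>"
  shows "\<langle>poly_op \<H> p T f, f\<rangle> \<le> \<langle>cont_calc \<H> \<phi> T f, f\<rangle>"
proof (rule field_le_epsilon)
  fix e :: real assume e: "0 < e"
  note TB = self_adjoint_bounded[OF T]
  define d where "d = e / (\<parallel>f\<parallel>\<^sup>2 + 1)"
  have d: "0 < d" "d * \<parallel>f\<parallel>\<^sup>2 \<le> e"
    using e by (auto simp: d_def divide_le_eq add_nonneg_pos)
  have "\<langle>poly_op \<H> p T f, f\<rangle> \<le> \<langle>cont_calc \<H> \<phi> T f, f\<rangle> + d * \<parallel>f\<parallel>\<^sup>2"
  proof (rule tendsto_lowerbound)
    show "(\<lambda>n. \<langle>poly_op \<H> (q n) T f, f\<rangle> + d * \<parallel>f\<parallel>\<^sup>2) \<longlonglongrightarrow> \<langle>cont_calc \<H> \<phi> T f, f\<rangle> + d * \<parallel>f\<parallel>\<^sup>2"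
      by (intro tendsto_intros cont_calc_ip_limit f)
    have "\<langle>poly_op \<H> p T f, f\<rangle> \<le> \<langle>poly_op \<H> (q n) T f, f\<rangle> + d * \<parallel>f\<parallel>\<^sup>2"
      if n: "\<forall>t\<in>real_spectrum T. dist (poly (q n) t) (\<phi> t) < d" for n
    proof -
      have "poly p t \<le> poly (q n + [:d:]) t" if "t \<in> real_spectrum T" for t
        using p[OF that] bspec[OF n that] by (auto simp: dist_real_def)
      then have "\<langle>poly_op \<H> p T f, f\<rangle> \<le> \<langle>poly_op \<H> (q n + [:d:]) T f, f\<rangle>"
        by (rule poly_op_mono_on_spectrum[OF T f])
      then show ?thesis
        using f poly_op_closed[OF TB f]
        by (simp add: poly_op_add poly_op_const[OF TB] ip_simps vnorm_sq)
    qed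
    then show "\<forall>\<^sub>F n in sequentially.
        \<langle>poly_op \<H> p T f, f\<rangle> \<le> \<langle>poly_op \<H> (q n) T f, f\<rangle> + d * \<parallel>f\<parallel>\<^sup>2"
      using eventually_mono[OF uniform_limitD[OF q d(1)]] by simp
  qed simp
  then show "\<langle>poly_op \<H> p T f, f\<rangle> \<le> \<langle>cont_calc \<H> \<phi> T f, f\<rangle> + e" using d(2) by linarith
qed

text \<open>
  The polynomials \<open>q\<^sub>n\<^sup>2\<close> tend uniformly to \<open>\<phi>\<^sup>2 = p\<close>, and \<open>\<parallel>q\<^sub>n(T) f\<parallel>\<^sup>2 = \<langle>q\<^sub>n\<^sup>2(T) f, f\<rangle>\<close>. Boundedness of
  \<open>\<phi>\<close> is what makes the squares converge uniformly.
\<close>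

lemma cont_calc_square:
  assumes bdd: "bounded (\<phi> ` real_spectrum T)"
    and p: "\<And>t. t \<in> real_spectrum T \<Longrightarrow> (\<phi> t)\<^sup>2 = poly p t" and f: "f \<in> vectors \<H>"
  shows "\<parallel>cont_calc \<H> \<phi> T f\<parallel>\<^sup>2 = \<langle>poly_op \<H> p T f, f\<rangle>"
proof -
  note TB = self_adjoint_bounded[OF T]
  have "uniform_limit (real_spectrum T) (\<lambda>n t. poly (q n) t * poly (q n) t) (\<lambda>t. \<phi> t * \<phi> t) sequentially"
    by (rule uniform_lim_mult[OF q q bdd bdd])
  then have lim: "uniform_limit (real_spectrum T) (\<lambda>n. poly ((q n)\<^sup>2)) (poly p) sequentially"
    by (rule uniform_limit_cong'[THEN iffD1, rotated 2]) (simp_all add: power2_eq_square flip: p)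
  \<comment> \<open>Constant sequences show that the calculus extends the polynomial one.\<close>
  have const: "uniform_limit (real_spectrum T) (\<lambda>n. poly p) (poly p) sequentially"
    by (rule uniform_limit_const)
  have "cont_calc \<H> (poly p) T f = poly_op \<H> p T f"
  proof (rule vlim_unique)
    show "(\<lambda>n. \<parallel>poly_op \<H> p T f - cont_calc \<H> (poly p) T f\<parallel>) \<longlonglongrightarrow> 0"
      by (rule cont_calc(2)[OF T const f])
  qed (use f poly_op_closed[OF TB f] op_closed[OF cont_calc(1)[OF T const] f] in simp_all)
  then have "(\<lambda>n. \<parallel>poly_op \<H> ((q n)\<^sup>2) T f - poly_op \<H> p T f\<parallel>) \<longlonglongrightarrow> 0"
    using cont_calc(2)[OF T lim f] by simp
  then have "(\<lambda>n. \<langle>poly_op \<H> ((q n)\<^sup>2) T f, f\<rangle>) \<longlonglongrightarrow> \<langle>poly_op \<H> p T f, f\<rangle>"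
    using f poly_op_closed[OF TB f] by (intro tendsto_Re tendsto_ip) auto
  moreover have "(\<lambda>n. \<parallel>poly_op \<H> (q n) T f\<parallel>\<^sup>2) \<longlonglongrightarrow> \<parallel>cont_calc \<H> \<phi> T f\<parallel>\<^sup>2"
    using poly_op_closed[OF TB f] op_closed[OF cont_calc(1)[OF T q] f]
    by (intro tendsto_power tendsto_vnorm cont_calc(2)[OF T q f]) auto
  ultimately show ?thesis
    using LIMSEQ_unique by (auto simp: poly_op_norm_sq[OF T f])
qed

end

section \<open>Powers of positive operators\<close>

definition positive_op :: "(('o \<Rightarrow> complex) \<Rightarrow> 'o \<Rightarrow> complex) \<Rightarrow> bool"
  where "positive_op T \<longleftrightarrow> self_adjoint T \<and> (\<forall>f\<in>vectors \<H>. 0 \<le> \<langle>T f, f\<rangle>)"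

lemma positive_spectrum:
  assumes "positive_op T"
  obtains M where "real_spectrum T \<subseteq> {0..M}"
proof -
  have T: "self_adjoint T" "\<And>f. f \<in> vectors \<H> \<Longrightarrow> 0 \<le> \<langle>T f, f\<rangle>"
    using assms by (auto simp: positive_op_def)
  note TB = self_adjoint_bounded[OF T(1)]
  obtain C where C: "0 < C" "\<And>f. f \<in> vectors \<H> \<Longrightarrow> \<parallel>T f\<parallel> \<le> C * \<parallel>f\<parallel>" using op_bound[OF TB] by blast
  have "real_spectrum T \<subseteq> {0..C}"
  proof (rule spectrum_in_interval[OF T(1)])
    fix f assume f: "f \<in> vectors \<H>"
    show "\<langle>T f, f\<rangle> \<le> C * \<parallel>f\<parallel>\<^sup>2"
      using order_trans[OF re_ip_le[OF op_closed[OF TB f] f] mult_right_mono[OF C(2)[OF f], of "\<parallel>f\<parallel>"]] f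
      by (simp add: power2_eq_square mult.assoc)
  qed (use T(2) in simp)
  then show ?thesis by (rule that)
qed

text \<open>
  The spectrum of a positive operator lies in an interval \<open>{0..M}\<close>, on which powers with positive
  exponents are continuous, so the Weierstrass approximation theorem applies.
\<close>

lemma powr_approximation:
  assumes "positive_op T" "0 < s"
  obtains q where "uniform_limit (real_spectrum T) (\<lambda>n. poly (q n)) (\<lambda>t. t powr s) sequentially"
proof -
  obtain M where M: "real_spectrum T \<subseteq> {0..M}" using positive_spectrum[OF assms(1)] .
  have "continuous_on {0..M} (\<lambda>t. t powr s)"
    using assms(2) by (intro continuous_on_powr') (auto intro: continuous_intros)
  then obtain q where "uniform_limit {0..M} (\<lambda>n. poly (q n)) (\<lambda>t. t powr s) sequentially"
    by (rule polynomial_approximation)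
  from uniform_limit_on_subset[OF this M] show ?thesis by (rule that)
qed

lemma positive_op_self_adjoint: "positive_op T \<Longrightarrow> self_adjoint T"
  by (simp add: positive_op_def)

lemma op_powr_ge_poly:
  assumes T: "positive_op T" and s: "0 < s" and f: "f \<in> vectors \<H>"
    and p: "\<And>t. 0 \<le> t \<Longrightarrow> poly p t \<le> t powr s"
  shows "\<langle>poly_op \<H> p T f, f\<rangle> \<le> \<langle>op_powr \<H> T s f, f\<rangle>"
proof -
  obtain q where q: "uniform_limit (real_spectrum T) (\<lambda>n. poly (q n)) (\<lambda>t. t powr s) sequentially"
    using powr_approximation[OF T s] .
  obtain M where M: "real_spectrum T \<subseteq> {0..M}" using positive_spectrum[OF T] .
  show ?thesis
    unfolding op_powr_def using M p by (intro cont_calc_mono[OF positive_op_self_adjoint[OF T] q _ f]) auto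
qed

lemma op_powr_positive:
  assumes T: "positive_op T" and s: "0 < s"
  shows "positive_op (op_powr \<H> T s)"
proof -
  obtain q where q: "uniform_limit (real_spectrum T) (\<lambda>n. poly (q n)) (\<lambda>t. t powr s) sequentially"
    using powr_approximation[OF T s] .
  have "self_adjoint (op_powr \<H> T s)"
    unfolding op_powr_def by (rule cont_calc_self_adjoint[OF positive_op_self_adjoint[OF T] q])
  moreover have "0 \<le> \<langle>op_powr \<H> T s f, f\<rangle>" if "f \<in> vectors \<H>" for f
    using op_powr_ge_poly[OF T s that, of 0] that by simp
  ultimately show ?thesis by (simp add: positive_op_def)
qed

lemma square_root_norm:
  assumes T: "positive_op T" and f: "f \<in> vectors \<H>"
  shows "\<parallel>op_powr \<H> T (1 / 2) f\<parallel>\<^sup>2 = \<langle>T f, f\<rangle>"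
proof -
  note TB = self_adjoint_bounded[OF positive_op_self_adjoint[OF T]]
  obtain q where q:
    "uniform_limit (real_spectrum T) (\<lambda>n. poly (q n)) (\<lambda>t. t powr (1 / 2)) sequentially"
    using powr_approximation[OF T] by (metis half_gt_zero zero_less_one)
  obtain M where M: "real_spectrum T \<subseteq> {0..M}" using positive_spectrum[OF T] .
  have "bounded ((\<lambda>t. t powr (1 / 2)) ` real_spectrum T)"
  proof (rule boundedI)
    fix y assume "y \<in> (\<lambda>t. t powr (1 / 2)) ` real_spectrum T"
    then show "norm y \<le> M powr (1 / 2)" using subsetD[OF M] by (force intro!: powr_mono2)
  qed
  moreover have "(t powr (1 / 2))\<^sup>2 = poly [:0, 1:] t" if "t \<in> real_spectrum T" for t
    using that M by (auto simp: powr_half_sqrt)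
  ultimately have "\<parallel>op_powr \<H> T (1 / 2) f\<parallel>\<^sup>2 = \<langle>poly_op \<H> [:0, 1:] T f, f\<rangle>"
    unfolding op_powr_def by (rule cont_calc_square[OF positive_op_self_adjoint[OF T] q _ _ f])
  then show ?thesis using f by (simp add: poly_op_linear[OF TB] fscale_simps)
qed

text \<open>
  \<open>\<parallel>\<bar>A\<bar> f\<parallel>\<^sup>2 = \<langle>A\<^sup>* A f, f\<rangle> = \<parallel>A f\<parallel>\<^sup>2\<close>. The operator \<open>\<bar>A\<bar>\<close> enters the proof only through this identity and
  its positivity.
\<close>

lemma abs_op:
  assumes A: "A \<in> bounded_ops \<H>"
  shows "positive_op (abs_op \<H> A)" and "f \<in> vectors \<H> \<Longrightarrow> \<parallel>abs_op \<H> A f\<parallel> = \<parallel>A f\<parallel>"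
proof -
  have P: "positive_op (adjoint_op \<H> A \<circ> A)"
    using adjoint_compose_self[OF A] by (simp add: positive_op_def)
  show Q: "positive_op (abs_op \<H> A)" unfolding abs_op_def by (rule op_powr_positive[OF P]) simp
  show "\<parallel>abs_op \<H> A f\<parallel> = \<parallel>A f\<parallel>" if f: "f \<in> vectors \<H>"
  proof -
    have "\<parallel>abs_op \<H> A f\<parallel>\<^sup>2 = \<parallel>A f\<parallel>\<^sup>2"
      unfolding abs_op_def square_root_norm[OF P f] by (rule adjoint_compose_self(2)[OF A f])
    then show ?thesis
      using vnorm_nonneg[OF op_closed[OF self_adjoint_bounded[OF positive_op_self_adjoint[OF Q]] f]]
        vnorm_nonneg[OF op_closed[OF A f]] by (simp add: power2_eq_iff_nonneg)
  qed
qed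

text \<open>
  Jensen's inequality for the convex function \<open>u powr r\<close>. With \<open>c = \<parallel>T f\<parallel>\<^sup>2\<close>, its tangent at \<open>c\<close>
  evaluated at \<open>u = t\<^sup>2\<close> is a polynomial in \<open>t\<close> below \<open>t powr (2 * r)\<close>. As \<open>\<langle>T\<^sup>2 f, f\<rangle> = c\<close>
  and \<open>\<parallel>f\<parallel> = 1\<close>, the quadratic form of this polynomial in \<open>T\<close> at \<open>f\<close> is the value of the tangent at \<open>c\<close>,
  that is, \<open>c powr r\<close>.
\<close>

lemma mccarthy_inequality:
  assumes T: "positive_op T" and f: "f \<in> vectors \<H>" "\<parallel>f\<parallel> = 1" and r: "1 \<le> r"
  shows "\<parallel>T f\<parallel> powr (2 * r) \<le> \<langle>op_powr \<H> T (2 * r) f, f\<rangle>"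
proof (cases "T f = 0")
  case True
  have "0 \<le> \<langle>op_powr \<H> T (2 * r) f, f\<rangle>"
    using op_powr_positive[OF T, of "2 * r"] r f by (simp add: positive_op_def)
  then show ?thesis using True by simp
next
  case False
  note TB = self_adjoint_bounded[OF positive_op_self_adjoint[OF T]]
  have sq: "u powr (2 * r) = (u\<^sup>2) powr r" if "0 \<le> u" for u :: real
    using that by (cases "u = 0") (simp_all add: powr_powr[symmetric])
  define c where "c = \<parallel>T f\<parallel>\<^sup>2"
  have c: "0 < c" using vnorm_pos[OF op_closed[OF TB f(1)] False] by (simp add: c_def)
  \<comment> \<open>The tangent to \<open>u\<^sup>r\<close> at \<open>c\<close> is \<open>a + b u\<close>.\<close>
  define b where "b = r * c powr (r - 1)"
  define a where "a = c powr r - b * c"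
  let ?p = "[:a:] + smult b ([:0, 1:]\<^sup>2)"
  have "\<langle>poly_op \<H> ?p T f, f\<rangle> \<le> \<langle>op_powr \<H> T (2 * r) f, f\<rangle>"
  proof (rule op_powr_ge_poly[OF T _ f(1)])
    fix t :: real assume t: "0 \<le> t"
    have "poly ?p t = c powr r + b * (t\<^sup>2 - c)"
      by (simp add: a_def power2_eq_square algebra_simps)
    also have "\<dots> \<le> (t\<^sup>2) powr r" unfolding b_def by (rule powr_above_tangent[OF c _ r]) simp
    finally show "poly ?p t \<le> t powr (2 * r)" by (simp add: sq[OF t])
  qed (use r in simp)
  also have "\<langle>poly_op \<H> ?p T f, f\<rangle> = a + b * \<parallel>T f\<parallel>\<^sup>2"
  proof -
    have "poly_op \<H> [:0, 1:] T f = T f" using f by (simp add: poly_op_linear[OF TB] fscale_simps)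
    then have "\<langle>poly_op \<H> ([:0, 1:]\<^sup>2) T f, f\<rangle> = \<parallel>T f\<parallel>\<^sup>2"
      using poly_op_norm_sq[OF positive_op_self_adjoint[OF T] f(1), of "[:0, 1:]"] by simp
    then show ?thesis
      using f poly_op_closed[OF TB f(1)] vnorm_sq[OF f(1)]
      by (simp add: poly_op_add poly_op_smult poly_op_const[OF TB] ip_simps)
  qed
  also have "a + b * \<parallel>T f\<parallel>\<^sup>2 = \<parallel>T f\<parallel> powr (2 * r)"
    using vnorm_nonneg[OF op_closed[OF TB f(1)]] by (simp add: a_def c_def sq)
  finally show ?thesis .
qed

section \<open>The Berezin number inequality\<close>

text \<open>
  Suprema of real sets without an upper bound are unspecified, so boundedness has to be known before
  Berezin numbers can be compared.
\<close>

lemma ber_bdd_above: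
  assumes S: "S \<in> bounded_ops \<H>" and k: "\<forall>x\<in>points \<H>. rep_kernel \<H> x \<noteq> 0"
  shows "bdd_above ((\<lambda>x. cmod (ip \<H> (S (normalized_kernel \<H> x)) (normalized_kernel \<H> x))) ` points \<H>)"
proof -
  obtain C where C: "0 < C" "\<And>f. f \<in> vectors \<H> \<Longrightarrow> \<parallel>S f\<parallel> \<le> C * \<parallel>f\<parallel>" using op_bound[OF S] by blast
  show ?thesis
  proof (rule bdd_aboveI2)
    fix x assume x: "x \<in> points \<H>"
    then have u: "normalized_kernel \<H> x \<in> vectors \<H>" "\<parallel>normalized_kernel \<H> x\<parallel> = 1"
      using normalized_kernel k by auto
    show "cmod (ip \<H> (S (normalized_kernel \<H> x)) (normalized_kernel \<H> x)) \<le> C"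
      using cauchy_schwarz[OF op_closed[OF S u(1)] u(1)] C(2)[OF u(1)] u(2) by simp
  qed
qed

text \<open>
  By the Cauchy-Schwarz inequality \<open>\<parallel>A f\<parallel>\<close> and \<open>\<parallel>A\<^sup>* f\<parallel>\<close> both bound
  \<open>cmod (ip \<H> (A f) f)\<close>; McCarthy's inequality applies to \<open>\<bar>A\<bar>\<close> and to \<open>\<bar>A\<^sup>*\<bar>\<close>.
\<close>

lemma ber_pointwise_bound:
  assumes A: "A \<in> bounded_ops \<H>" and f: "f \<in> vectors \<H>" "\<parallel>f\<parallel> = 1"
    and r: "1 \<le> r" and \<alpha>: "0 \<le> \<alpha>" "\<alpha> \<le> 1"
  shows "cmod (ip \<H> (A f) f) powr (2 * r) \<le>
    \<alpha> * \<langle>op_powr \<H> (abs_op \<H> A) (2 * r) f, f\<rangle>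
    + (1 - \<alpha>) * \<langle>op_powr \<H> (abs_op \<H> (adjoint_op \<H> A)) (2 * r) f, f\<rangle>"
proof -
  have bound: "cmod (ip \<H> (A f) f) powr (2 * r) \<le> \<langle>op_powr \<H> (abs_op \<H> B) (2 * r) f, f\<rangle>"
    if B: "B \<in> bounded_ops \<H>" and le: "cmod (ip \<H> (A f) f) \<le> \<parallel>B f\<parallel>" for B
  proof -
    have "cmod (ip \<H> (A f) f) powr (2 * r) \<le> \<parallel>abs_op \<H> B f\<parallel> powr (2 * r)"
      using le r abs_op(2)[OF B f(1)] by (intro powr_mono2) auto
    also have "\<dots> \<le> \<langle>op_powr \<H> (abs_op \<H> B) (2 * r) f, f\<rangle>"
      by (rule mccarthy_inequality[OF abs_op(1)[OF B] f r])
    finally show ?thesis .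
  qed
  have "cmod (ip \<H> (A f) f) \<le> \<parallel>A f\<parallel>"
    using cauchy_schwarz[OF op_closed[OF A f(1)] f(1)] f(2) by simp
  moreover have "cmod (ip \<H> (A f) f) \<le> \<parallel>adjoint_op \<H> A f\<parallel>"
    using cauchy_schwarz[OF f(1) op_closed[OF adjoint_bounded[OF A] f(1)]] f(2)
    by (simp add: adjoint_ip[OF A f(1) f(1)])
  ultimately have "cmod (ip \<H> (A f) f) powr (2 * r) \<le> \<langle>op_powr \<H> (abs_op \<H> A) (2 * r) f, f\<rangle>"
    "cmod (ip \<H> (A f) f) powr (2 * r) \<le> \<langle>op_powr \<H> (abs_op \<H> (adjoint_op \<H> A)) (2 * r) f, f\<rangle>"
    using bound A adjoint_bounded[OF A] by blast+
  from add_mono[OF mult_left_mono[OF this(1) \<alpha>(1)] mult_left_mono[OF this(2), of "1 - \<alpha>"]] \<alpha>(2)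
  show ?thesis by (simp add: algebra_simps)
qed

end

theorem theorem2p6:
  fixes \<H> :: "'o function_space"
    and A :: "('o \<Rightarrow> complex) \<Rightarrow> 'o \<Rightarrow> complex"
    and r \<alpha> :: real
  assumes "rkhs \<H>"
    and "\<forall>x\<in>points \<H>. rep_kernel \<H> x \<noteq> 0"
    and "A \<in> bounded_ops \<H>"
    and "1 \<le> r"
    and "0 \<le> \<alpha>" and "\<alpha> \<le> 1"
  shows "ber \<H> A powr (2 * r) \<le>
    ber \<H> (\<lambda>f. complex_of_real \<alpha> \<cdot> op_powr \<H> (abs_op \<H> A) (2 * r) f +
      complex_of_real (1 - \<alpha>) \<cdot> op_powr \<H> (abs_op \<H> (adjoint_op \<H> A)) (2 * r) f)"
proof -
  interpret rkhs \<H> by fact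
  note A = assms(3) and kernels = assms(2)
  let ?k = "normalized_kernel \<H>"
  let ?P = "op_powr \<H> (abs_op \<H> A) (2 * r)"
  let ?Q = "op_powr \<H> (abs_op \<H> (adjoint_op \<H> A)) (2 * r)"
  let ?S = "\<lambda>f. complex_of_real \<alpha> \<cdot> ?P f + complex_of_real (1 - \<alpha>) \<cdot> ?Q f"
  have PQ: "?P \<in> bounded_ops \<H>" "?Q \<in> bounded_ops \<H>"
    using abs_op(1)[OF A] abs_op(1)[OF adjoint_bounded[OF A]] assms(4)
    by (auto intro!: self_adjoint_bounded positive_op_self_adjoint op_powr_positive)
  have S: "?S \<in> bounded_ops \<H>" by (rule op_linear_combination[OF PQ])
  have unit: "?k x \<in> vectors \<H>" "\<parallel>?k x\<parallel> = 1" if "x \<in> points \<H>" for x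
    using normalized_kernel[OF that] kernels that by auto
  have pointwise: "cmod (ip \<H> (A (?k x)) (?k x)) powr (2 * r) \<le> ber \<H> ?S"
    if x: "x \<in> points \<H>" for x
  proof -
    note f = unit[OF x]
    have "cmod (ip \<H> (A (?k x)) (?k x)) powr (2 * r)
        \<le> \<alpha> * \<langle>?P (?k x), ?k x\<rangle> + (1 - \<alpha>) * \<langle>?Q (?k x), ?k x\<rangle>"
      by (rule ber_pointwise_bound[OF A f assms(4-6)])
    also have "\<dots> = \<langle>?S (?k x), ?k x\<rangle>"
      using f op_closed[OF PQ(1) f(1)] op_closed[OF PQ(2) f(1)]
      by (simp add: ip_add ip_scale del: of_real_diff)
    also have "\<dots> \<le> cmod (ip \<H> (?S (?k x)) (?k x))" by (rule complex_Re_le_cmod)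
    also have "\<dots> \<le> ber \<H> ?S"
      unfolding ber_def using x by (rule cSUP_upper[OF _ ber_bdd_above[OF S kernels]])
    finally show ?thesis .
  qed
  obtain y where y: "y \<in> points \<H>" using points_nonempty by blast
  have ber_S: "0 \<le> ber \<H> ?S"
    using order_trans[OF powr_ge_zero pointwise[OF y]] .
  have "ber \<H> A \<le> ber \<H> ?S powr (1 / (2 * r))"
    unfolding ber_def[of \<H> A]
  proof (rule cSUP_least[OF points_nonempty])
    fix x assume x: "x \<in> points \<H>"
    have "cmod (ip \<H> (A (?k x)) (?k x))
        = (cmod (ip \<H> (A (?k x)) (?k x)) powr (2 * r)) powr (1 / (2 * r))"
      using assms(4) by (simp add: powr_powr)
    also have "\<dots> \<le> ber \<H> ?S powr (1 / (2 * r))"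
      using pointwise[OF x] assms(4) by (intro powr_mono2) auto
    finally show "cmod (ip \<H> (A (?k x)) (?k x)) \<le> ber \<H> ?S powr (1 / (2 * r))" .
  qed
  moreover have "0 \<le> ber \<H> A"
    unfolding ber_def using y
    by (intro cSUP_upper2[OF ber_bdd_above[OF A kernels] y]) simp
  ultimately have "ber \<H> A powr (2 * r) \<le> (ber \<H> ?S powr (1 / (2 * r))) powr (2 * r)"
    using assms(4) by (intro powr_mono2) auto
  also have "\<dots> = ber \<H> ?S" using ber_S assms(4) by (simp add: powr_powr)
  finally show ?thesis .
qed

end
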